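(* Let $a$ be a square-free positive integer such that $L=\mathbb{Q}(\sqrt{a})$ is a real quadratic field which is ramified at $2$, has trivial class group, and is such that the reduction map $\mathcal{O}_L^*\to(\mathcal{O}_L/\mathfrak{p})^*$ is surjective for infinitely many prime ideals $\mathfrak{p}\subseteq\mathcal{O}_L$ of degree $1$ over $\mathbb{Q}$. Let $\mathcal{X}\subseteq\mathbb{A}^3_{\mathbb{Z}}$ be the affine scheme given by the equation $$(x^2-ay^2)t=y-1 .$$ Then the set $\mathcal{X}(\mathbb{Z})$ of integral points is Zariski dense.
   Context: $\mathcal{O}_L$ denotes the ring of integers of $L$. A prime ideal $\mathfrak p$ of $\mathcal{O}_L$ has degree $1$ over $\mathbb{Q}$ if $\mathcal{O}_L/\mathfrak{p}$ is a prime field $\mathbb{F}_p$. *)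

theory Defs
  imports
    "HOL-Analysis.Abstract_Topology"
    "HOL-Algebra.Algebra"
    "HOL-Algebra.Algebraic_Closure_Type"
    "HOL-Number_Theory.Residues"
begin

section \<open>Real quadratic fields and their rings of integers\<close>

abbreviation real_ring :: "real ring" where
  "real_ring \<equiv> ring_of_type_algebra"

definition quadratic_field :: "int \<Rightarrow> real set" where
  "quadratic_field a = generate_field real_ring {sqrt (of_int a)}"

lemma field_real_ring: "field real_ring" by (rule field_from_type_algebra)

lemma inv_real_ring: "x \<noteq> 0 \<Longrightarrow> inv\<^bsub>real_ring\<^esub> x = inverse x"
proof -
  assume "x \<noteq> 0"
  interpret field real_ring by (rule field_real_ring)
  show ?thesis by (rule comm_inv_char) (use \<open>x \<noteq> 0\<close> in \<open>auto simp: ring_of_type_algebra_def\<close>)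
qed

lemma uminus_real_ring: "\<ominus>\<^bsub>real_ring\<^esub> x = - x"
proof -
  interpret field real_ring by (rule field_real_ring)
  show ?thesis by (rule minus_equality) (auto simp: ring_of_type_algebra_def)
qed

lemma quadratic_field_eq:
  assumes "a > 0"
  shows "quadratic_field a = {p + q * sqrt (of_int a) | p q. p \<in> \<rat> \<and> q \<in> \<rat>}" (is "?A = ?B")
proof
  let ?s = "sqrt (of_int a) :: real"
  have s: "?s * ?s = of_int a" using assms by simp
  show "?A \<subseteq> ?B"
  proof
    fix x assume "x \<in> ?A"
    then show "x \<in> ?B" unfolding quadratic_field_def
    proof induction
      case one
      have "1 = (1::real) + 0 * ?s" by simp
      then have "(1::real) \<in> ?B" by (blast intro: Rats_0 Rats_1)
      then show ?case by (simp add: ring_of_type_algebra_def)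
    next
      case (incl h)
      then have "h = 0 + 1 * ?s" by simp
      then show ?case by (blast intro: Rats_0 Rats_1)
    next
      case (a_inv h)
      then obtain p q where "h = p + q * ?s" "p \<in> \<rat>" "q \<in> \<rat>" by blast
      then have "- h = - p + (- q) * ?s" "-p \<in> \<rat>" "-q \<in> \<rat>" by auto
      then show ?case unfolding uminus_real_ring by blast
    next
      case (m_inv h)
      then obtain p q where h: "h = p + q * ?s" "p \<in> \<rat>" "q \<in> \<rat>" by blast
      have h0: "h \<noteq> 0" using m_inv by (simp add: ring_of_type_algebra_def)
      show ?case
      proof (cases "p - q * ?s = 0")
        case True
        then have "h = 2 * p" using h by simp
        then have "inverse h = inverse (2 * p) + 0 * ?s" "inverse (2*p) \<in> \<rat>" using h by auto
        then show ?thesis unfolding inv_real_ring[OF h0] by (blast intro: Rats_0)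
      next
        case False
        define N where "N = p * p - of_int a * q * q"
        have N: "N = h * (p - q * ?s)" unfolding N_def h using assms by (simp add: algebra_simps)
        then have "N \<noteq> 0" using False h0 by simp
        then have "inverse h = (p - q * ?s) / N" unfolding N using h0 False by (simp add: inverse_eq_divide)
        then have "inverse h = p / N + (- q / N) * ?s" by (simp add: diff_divide_distrib)
        moreover have "p / N \<in> \<rat>" "- q / N \<in> \<rat>" unfolding N_def using h by auto
        ultimately show ?thesis unfolding inv_real_ring[OF h0] by blast
      qed
    next
      case (eng_add h1 h2)
      then obtain p q p' q' where "h1 = p + q * ?s" "p \<in> \<rat>" "q \<in> \<rat>" "h2 = p' + q' * ?s" "p' \<in> \<rat>" "q' \<in> \<rat>" by blast
      then have "h1 + h2 = (p + p') + (q + q') * ?s" "p + p' \<in> \<rat>" "q + q' \<in> \<rat>" by (auto simp: algebra_simps)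
      then show ?case by (auto simp: ring_of_type_algebra_def)
    next
      case (eng_mult h1 h2)
      then obtain p q p' q' where h: "h1 = p + q * ?s" "p \<in> \<rat>" "q \<in> \<rat>" "h2 = p' + q' * ?s" "p' \<in> \<rat>" "q' \<in> \<rat>" by blast
      have "h1 * h2 = p * p' + q * q' * (?s * ?s) + (p * q' + q * p') * ?s" unfolding h by (simp only: algebra_simps)
      then have "h1 * h2 = (p * p' + q * q' * of_int a) + (p * q' + q * p') * ?s" unfolding s .
      moreover have "p * p' + q * q' * of_int a \<in> \<rat>" "p * q' + q * p' \<in> \<rat>" using h by auto
      ultimately show ?case by (auto simp: ring_of_type_algebra_def)
    qed
  qed
next
  let ?s = "sqrt (of_int a) :: real"
  interpret field real_ring by (rule field_real_ring)
  have sf: "subfield ?A real_ring" unfolding quadratic_field_def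
    by (rule generate_field_is_subfield) (simp add: ring_of_type_algebra_def)
  have add: "x + y \<in> ?A" if "x \<in> ?A" "y \<in> ?A" for x y
    using generate_field.eng_add[of x real_ring _ y] that unfolding quadratic_field_def by (simp add: ring_of_type_algebra_def)
  have mult: "x * y \<in> ?A" if "x \<in> ?A" "y \<in> ?A" for x y
    using generate_field.eng_mult[of x real_ring _ y] that unfolding quadratic_field_def by (simp add: ring_of_type_algebra_def)
  have one: "1 \<in> ?A" using generate_field.one[of real_ring] unfolding quadratic_field_def by (simp add: ring_of_type_algebra_def)
  have neg: "- x \<in> ?A" if "x \<in> ?A" for x
    using generate_field.a_inv[of x real_ring] that unfolding quadratic_field_def by (simp add: uminus_real_ring)
  have zero: "0 \<in> ?A" using add[OF one neg[OF one]] by simp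
  have inv: "inverse x \<in> ?A" if "x \<in> ?A" for x
    using generate_field.m_inv[of x real_ring] that zero inv_real_ring[of x] unfolding quadratic_field_def by (cases "x = 0") (auto simp: ring_of_type_algebra_def)
  have nat: "of_nat n \<in> ?A" for n by (induction n) (auto intro: add zero one)
  have int: "of_int k \<in> ?A" for k using nat neg by (cases k) (auto simp del: of_nat_Suc)
  have rat: "r \<in> ?A" if "r \<in> \<rat>" for r
    using that by (auto elim!: Rats_cases' simp: divide_inverse intro!: mult int inv)
  have "?s \<in> ?A" unfolding quadratic_field_def by (rule generate_field.incl) simp
  then show "?B \<subseteq> ?A" using rat add mult by auto
qed

definition ring_of_integers :: "real set \<Rightarrow> real ring" where
  "ring_of_integers K = real_ring\<lparr>carrier := {x \<in> K. algebraic_int x}\<rparr>"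

definition ramified_at :: "real set \<Rightarrow> nat \<Rightarrow> bool" where
  "ramified_at K p \<longleftrightarrow>
    (let R = ring_of_integers K in
      \<exists>P J. primeideal P R \<and> ideal J R \<and> Idl\<^bsub>R\<^esub> {of_nat p} = P \<cdot>\<^bsub>R\<^esub> P \<cdot>\<^bsub>R\<^esub> J)"

definition fractional_ideals :: "real set \<Rightarrow> real set set" where
  "fractional_ideals K =
    (let O_K = carrier (ring_of_integers K) in
      {I. I \<subseteq> K \<and> I \<noteq> {0} \<and> 0 \<in> I \<and> (\<forall>x\<in>I. \<forall>y\<in>I. x - y \<in> I) \<and>
          (\<forall>r\<in>O_K. \<forall>x\<in>I. r * x \<in> I) \<and> (\<exists>d\<in>O_K - {0}. \<forall>x\<in>I. d * x \<in> O_K)})"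

definition principal_fractional_ideals :: "real set \<Rightarrow> real set set" where
  "principal_fractional_ideals K =
    {(\<lambda>x. c * x) ` carrier (ring_of_integers K) | c. c \<in> K - {0}}"

text \<open>The operation \<^const>\<open>ideal_prod\<close> yields all finite nonempty sums of products
  \<open>x * y\<close> with \<open>x \<in> I\<close>, \<open>y \<in> J\<close>; it only uses the ambient ring
  operations and hence also computes products of fractional ideals.\<close>

definition fractional_ideal_group :: "real set \<Rightarrow> real set monoid" where
  "fractional_ideal_group K =
    \<lparr>carrier = fractional_ideals K, monoid.mult = ideal_prod real_ring,
     one = carrier (ring_of_integers K)\<rparr>"

definition class_group :: "real set \<Rightarrow> real set set monoid" where
  "class_group K = fractional_ideal_group K Mod principal_fractional_ideals K"

definition degree_one_prime :: "real set \<Rightarrow> real set \<Rightarrow> bool" where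
  "degree_one_prime K P \<longleftrightarrow> primeideal P (ring_of_integers K) \<and>
    (\<exists>p::nat. Factorial_Ring.prime p \<and> ring_of_integers K Quot P \<simeq> residue_ring (int p))"

definition unit_reduction_surjective :: "real set \<Rightarrow> real set \<Rightarrow> bool" where
  "unit_reduction_surjective K P \<longleftrightarrow>
    (let R = ring_of_integers K in (\<lambda>u. P +>\<^bsub>R\<^esub> u) ` Units R = Units (R Quot P))"

section \<open>The Zariski topology\<close>

definition spec :: "'a ring \<Rightarrow> 'a set set" where
  "spec R = {P. primeideal P R}"

definition zero_locus :: "'a ring \<Rightarrow> 'a set \<Rightarrow> 'a set set" where
  "zero_locus R S = {P \<in> spec R. S \<subseteq> P}"

definition zariski_topology :: "'a ring \<Rightarrow> 'a set topology" where
  "zariski_topology R = topology (\<lambda>U. \<exists>S\<subseteq>carrier R. U = spec R - zero_locus R S)"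

lemma zero_locus_Int:
  assumes "S \<subseteq> carrier R" "T \<subseteq> carrier R"
  shows "(spec R - zero_locus R S) \<inter> (spec R - zero_locus R T) =
         spec R - zero_locus R {s \<otimes>\<^bsub>R\<^esub> t | s t. s \<in> S \<and> t \<in> T}"
proof -
  have "({s \<otimes>\<^bsub>R\<^esub> t | s t. s \<in> S \<and> t \<in> T} \<subseteq> P) \<longleftrightarrow> S \<subseteq> P \<or> T \<subseteq> P"
    if "primeideal P R" for P
  proof -
    interpret primeideal P R by fact
    show ?thesis
      using assms I_prime I_l_closed I_r_closed by blast
  qed
  then show ?thesis
    unfolding zero_locus_def spec_def by blast
qed

lemma istopology_zariski:
  "istopology (\<lambda>U. \<exists>S\<subseteq>carrier R. U = spec R - zero_locus R S)"
  unfolding istopology_def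
proof (intro conjI allI impI)
  fix U V
  assume "\<exists>S\<subseteq>carrier R. U = spec R - zero_locus R S"
    and "\<exists>S\<subseteq>carrier R. V = spec R - zero_locus R S"
  then obtain S T where ST: "S \<subseteq> carrier R" "U = spec R - zero_locus R S"
    "T \<subseteq> carrier R" "V = spec R - zero_locus R T" by blast
  show "\<exists>S\<subseteq>carrier R. U \<inter> V = spec R - zero_locus R S"
  proof (cases "spec R = {}")
    case True
    then show ?thesis using ST by auto
  next
    case False
    then obtain P where "primeideal P R" by (auto simp: spec_def)
    then interpret primeideal P R .
    have "{s \<otimes>\<^bsub>R\<^esub> t | s t. s \<in> S \<and> t \<in> T} \<subseteq> carrier R" using ST by auto
    then show ?thesis using ST zero_locus_Int[of S R T] by blast
  qed
next
  fix \<U>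
  assume "\<forall>U\<in>\<U>. \<exists>S\<subseteq>carrier R. U = spec R - zero_locus R S"
  then obtain f where f: "\<And>U. U \<in> \<U> \<Longrightarrow> f U \<subseteq> carrier R \<and> U = spec R - zero_locus R (f U)"
    by metis
  have "\<Union>\<U> = spec R - zero_locus R (\<Union>(f ` \<U>))"
    using f unfolding zero_locus_def by blast
  moreover have "\<Union>(f ` \<U>) \<subseteq> carrier R" using f by blast
  ultimately show "\<exists>S\<subseteq>carrier R. \<Union>\<U> = spec R - zero_locus R S" by blast
qed

lemma openin_zariski_topology:
  "openin (zariski_topology R) U \<longleftrightarrow> (\<exists>S\<subseteq>carrier R. U = spec R - zero_locus R S)"
  unfolding zariski_topology_def by (simp add: topology_inverse'[OF istopology_zariski])

section \<open>Hypersurfaces in affine 3-space over the integers\<close>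

text \<open>The ring \<open>\<int>[x,y,t]\<close> is realised as \<open>\<int>[x][y][t]\<close>.\<close>

type_synonym poly3 = "int poly poly poly"

abbreviation poly3_ring :: "poly3 ring" where
  "poly3_ring \<equiv> ring_of_type_algebra"

abbreviation ZZ_ring :: "int ring" where
  "ZZ_ring \<equiv> ring_of_type_algebra"

definition X_var :: poly3 where "X_var = [:[:[:0, 1:]:]:]"
definition Y_var :: poly3 where "Y_var = [:[:0, 1:]:]"
definition T_var :: poly3 where "T_var = [:0, 1:]"

definition eval3 :: "poly3 \<Rightarrow> int \<times> int \<times> int \<Rightarrow> int" where
  "eval3 f = (\<lambda>(x, y, t). poly (poly (poly f [:[:t:]:]) [:y:]) x)"

lemma eval3_simps [simp]:
  "eval3 X_var (x, y, t) = x" "eval3 Y_var (x, y, t) = y" "eval3 T_var (x, y, t) = t"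
  "eval3 (f + g) z = eval3 f z + eval3 g z" "eval3 (f - g) z = eval3 f z - eval3 g z"
  "eval3 (f * g) z = eval3 f z * eval3 g z" "eval3 (f ^ n) z = eval3 f z ^ n"
  "eval3 0 z = 0" "eval3 1 z = 1" "eval3 (of_int k) z = k"
  by (auto simp: eval3_def X_var_def Y_var_def T_var_def of_int_poly split: prod.splits)

text \<open>The underlying space of the closed subscheme \<open>f = 0\<close> of affine 3-space\<close>

definition hypersurface :: "poly3 \<Rightarrow> poly3 set set" where
  "hypersurface f = zero_locus poly3_ring {f}"

definition integral_points :: "poly3 \<Rightarrow> (int \<times> int \<times> int) set" where
  "integral_points f = {z. eval3 f z = 0}"

text \<open>An integral point \<open>z\<close> is a morphism from \<open>Spec \<int>\<close>, dual to evaluation at \<open>z\<close>.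
  Its image consists of the preimages under evaluation of the primes of \<open>\<int>\<close>
  (including the zero ideal).\<close>

definition point_image :: "int \<times> int \<times> int \<Rightarrow> poly3 set set" where
  "point_image z = (\<lambda>Q. {f. eval3 f z \<in> Q}) ` spec ZZ_ring"

lemma point_image_subset_hypersurface: "z \<in> integral_points f \<Longrightarrow> point_image z \<subseteq> hypersurface f"
proof
  fix P assume z: "z \<in> integral_points f" "P \<in> point_image z"
  then obtain Q where Q: "primeideal Q ZZ_ring" "P = {f. eval3 f z \<in> Q}" unfolding point_image_def spec_def by auto
  interpret Q: primeideal Q ZZ_ring by (rule Q)
  have q: "x + y \<in> Q" if "x \<in> Q" "y \<in> Q" for x y using that additive_subgroup.a_closed[OF ideal.axioms(1)[OF Q.ideal_axioms], of x y] by (simp add: ring_of_type_algebra_def)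
  have q0: "0 \<in> Q" using additive_subgroup.zero_closed[OF ideal.axioms(1)[OF Q.ideal_axioms]] by (simp add: ring_of_type_algebra_def)
  have qm: "r * x \<in> Q" if "x \<in> Q" for r x using that Q.I_l_closed[of x r] by (simp add: ring_of_type_algebra_def)
  have pp: "x \<in> Q \<or> y \<in> Q" if "x * y \<in> Q" for x y using that Q.I_prime[of x y] by (simp add: ring_of_type_algebra_def)
  have n1: "1 \<notin> Q" using Q.one_imp_carrier Q.I_notcarr by (auto simp add: ring_of_type_algebra_def)
  interpret R: cring poly3_ring by (rule cring_from_type_algebra)
  have um: "\<ominus>\<^bsub>poly3_ring\<^esub> x = - x" for x by (rule R.minus_equality) (auto simp: ring_of_type_algebra_def)
  have "primeideal P poly3_ring"
  proof (rule primeidealI)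
    show "ideal P poly3_ring"
    proof (rule idealI)
      show "subgroup P (add_monoid poly3_ring)"
      proof (rule R.add.subgroupI)
        fix x assume "x \<in> P" 
        then have "(0 - 1) * x \<in> P" unfolding Q by (simp only: mem_Collect_eq eval3_simps qm)
        then show "\<ominus>\<^bsub>poly3_ring\<^esub> x \<in> P" unfolding um by simp
      next
        have "0 \<in> P" using q0 Q by (simp)
        then show "P \<noteq> {}" by auto
      qed (auto simp: Q ring_of_type_algebra_def q)
    next
      show "ring poly3_ring" by (rule R.ring_axioms)
    next
      fix f g assume "f \<in> P"
      then show "g \<otimes>\<^bsub>poly3_ring\<^esub> f \<in> P" "f \<otimes>\<^bsub>poly3_ring\<^esub> g \<in> P"
        using qm[of "eval3 f z" "eval3 g z"] by (auto simp: Q ring_of_type_algebra_def mult.commute)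
    qed
  next
    show "carrier poly3_ring \<noteq> P" using n1 by (auto simp: ring_of_type_algebra_def Q set_eq_iff intro: exI[of _ 1])
  next
    show "cring poly3_ring" by (rule R.cring_axioms)
  qed (auto simp: Q ring_of_type_algebra_def dest!: pp)
  then show "P \<in> hypersurface f" using z(1) q0 unfolding hypersurface_def zero_locus_def spec_def Q integral_points_def by auto
qed

definition integral_points_zariski_dense :: "poly3 \<Rightarrow> bool" where
  "integral_points_zariski_dense f \<longleftrightarrow>
    (subtopology (zariski_topology poly3_ring) (hypersurface f)) closure_of
      (\<Union>z\<in>integral_points f. point_image z) = hypersurface f"

end

theory Submission
  imports Defs
begin

text \<open>
Write \<open>N(x, y) = x\<^sup>2 - a y\<^sup>2\<close>. A pair \<open>(x, y)\<close> of integers lifts to an integral point of the surface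
exactly when \<open>N(x, y)\<close> divides \<open>y - 1\<close> (for \<open>N(x, y) \<noteq> 0\<close>), so every nonzero integer \<open>n\<close> contributes
the points on the conic \<open>N = n\<close> with \<open>n\<close> dividing \<open>y - 1\<close>. There are infinitely many \<open>n\<close> whose conic
carries infinitely many such points, and points spread over infinitely many curves of the surface,
infinitely many on each, lie in no smaller closed set.

The arithmetic: as \<open>a\<close> is square-free, ramification at \<open>2\<close> forces \<open>a\<close> to be \<open>2\<close> or \<open>3\<close> modulo \<open>4\<close>
(\<open>ramified_at_2_imp_mod_4\<close>), hence the ring of integers is \<open>\<int>[s]\<close> with \<open>s = \<surd>a\<close>, and conics are
norm equations in it. Let \<open>P\<close> be a prime of degree one over \<open>p\<close>, let \<open>r\<close> be the image of \<open>s\<close> in the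
residue field, and let \<open>\<pi> = c + d s\<close> generate \<open>P\<close>; then \<open>N(\<pi>) = \<plusminus>p\<close>, \<open>c \<equiv> - d r\<close>, and \<open>p\<close> does not
divide \<open>d\<close>. For a unit \<open>u = e + f s\<close> the \<open>s\<close>-coordinate of \<open>\<pi> u\<close> is
\<open>c f + d e \<equiv> d (e - f r)\<close> modulo \<open>p\<close>, that is, \<open>d\<close> times the residue of the conjugate of \<open>u\<close>, which
is \<open>\<plusminus>1\<close> over the residue of \<open>u\<close>. Surjectivity of the reduction of units supplies \<open>u\<close> with residue
\<open>d\<close>, and up to sign \<open>\<pi> u\<close> is then a point with \<open>y \<equiv> 1\<close> on a conic \<open>N = \<plusminus>p\<close>
(\<open>conic_point_from_unit\<close>). Multiplying it with powers of a unit of infinite order that are congruent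
to \<open>1\<close> modulo \<open>P\<close> gives infinitely many points on the same conic
(\<open>infinitely_many_points_on_conic\<close>); the unit of infinite order comes from surjectivity too, at some
\<open>p \<ge> 5\<close>, where \<open>\<plusminus>1\<close> do not exhaust the residue classes.

The geometry: the equation is linear in \<open>t\<close>, with leading coefficient \<open>N\<close>. Pseudo-division turns a
polynomial \<open>f\<close> that vanishes on all integral points into a remainder \<open>g(x, y)\<close> that vanishes at
infinitely many points on infinitely many conics. In the coordinates \<open>u = x + s y\<close>, \<open>v = x - s y\<close> the
conics are the hyperbolas \<open>u v = n\<close>, on which \<open>g\<close> is a one-variable polynomial in \<open>u\<close> up to a power
of \<open>u\<close>, so \<open>g = 0\<close> (\<open>vanishes_on_infinitely_many_conics\<close>). Since \<open>N\<close> and \<open>y - 1\<close> are coprime the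
power of \<open>N\<close> cancels, and the equation of the surface divides \<open>f\<close>. This is density, because the
generic point of each integral point already detects whether \<open>f\<close> vanishes there.
\<close>

section \<open>Polynomials vanishing on infinitely many conics\<close>

lemma quadratic_coordinates_unique:
  fixes s :: real and x y x' y' :: int
  assumes "s \<notin> \<rat>" "of_int x + of_int y * s = of_int x' + of_int y' * s"
  shows "x = x' \<and> y = y'"
proof -
  have e: "of_int (y - y') * s = of_int (x' - x)" using assms(2) by (simp add: algebra_simps)
  have "y = y'"
  proof (rule ccontr)
    assume "y \<noteq> y'"
    then have "s = of_int (x' - x) / of_int (y - y')" using e by (simp add: field_simps)
    then show False using assms(1) by (metis Rats_divide Rats_of_int)
  qed
  then show ?thesis using assms(2) by simp
qed

text \<open>Ordinary division fails because the leading coefficient \<open>N\<close> is not a unit;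
one factor \<open>N\<close> for each degree of \<open>f\<close> repairs this.\<close>

lemma pseudo_division_by_linear:
  fixes b N :: "'a::comm_ring_1"
  shows "\<exists>k q r. smult (N ^ k) f = [:- b, N:] * q + [:r:]"
proof (induction f)
  case 0
  show ?case by (intro exI[of _ 0]) simp
next
  case (pCons c f)
  then obtain k q r where IH: "smult (N ^ k) f = [:- b, N:] * q + [:r:]" by blast
  have "smult (N ^ Suc k) (pCons c f) = [:N ^ Suc k * c:] + pCons 0 (smult N (smult (N ^ k) f))"
    by simp
  also have "\<dots> = [:- b, N:] * (pCons 0 (smult N q) + [:r:]) + [:N ^ Suc k * c + b * r:]"
    unfolding IH by (simp add: smult_add_right smult_diff_right algebra_simps)
  finally show ?case by blast
qed

text \<open>The coordinates \<open>u = x + s y\<close> and \<open>v = x - s y\<close> factor the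
form \<open>x\<^sup>2 - s\<^sup>2 y\<^sup>2\<close> as \<open>u v\<close>; the polynomial
\<open>S(u, v)\<close> is \<open>R((u + v) / 2, (u - v) / (2 s))\<close>.\<close>

lemma bivariate_change_of_variables:
  fixes R :: "int poly poly" and s :: real
  assumes "s \<noteq> 0"
  shows "\<exists>S :: real poly poly. \<forall>x y.
    poly (poly S [:of_int x - s * of_int y:]) (of_int x + s * of_int y) = of_int (poly (poly R [:y:]) x)"
proof (induction R)
  case 0
  show ?case by (intro exI[of _ 0]) simp
next
  case (pCons c R)
  then obtain S where S: "\<And>x y. poly (poly S [:of_int x - s * of_int y:]) (of_int x + s * of_int y) = of_int (poly (poly R [:y:]) x)"
    by blast
  have "\<exists>C :: real poly poly. \<forall>x y.
    poly (poly C [:of_int x - s * of_int y:]) (of_int x + s * of_int y) = of_int (poly c x)"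
  proof (induction c)
    case 0
    show ?case by (intro exI[of _ 0]) simp
  next
    case (pCons d c)
    then obtain C where C: "\<And>x y. poly (poly C [:of_int x - s * of_int y:]) (of_int x + s * of_int y) = of_int (poly c x)"
      by blast
    show ?case
      by (intro exI[of _ "[:[:of_int d:]:] + [:[:0, 1/2:], [:1/2:]:] * C"])
        (simp add: C field_simps)
  qed
  then obtain C where C: "\<And>x y. poly (poly C [:of_int x - s * of_int y:]) (of_int x + s * of_int y) = of_int (poly c x)"
    by blast
  show ?case
    by (intro exI[of _ "C + [:[:0, 1/(2*s):], [:-1/(2*s):]:] * S"])
      (use assms in \<open>simp add: C S field_simps\<close>)
qed

text \<open>On the hyperbola \<open>u v = n\<close> clearing the powers of \<open>1 / u\<close>
leaves a polynomial in \<open>u\<close>, to which the finiteness of roots applies.\<close>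

lemma hyperbola_restriction:
  fixes S :: "real poly poly" and n :: real
  shows "\<exists>H k. \<forall>u. u \<noteq> 0 \<longrightarrow> poly H u = u ^ k * poly (poly S [:n / u:]) u"
proof (induction S)
  case 0
  show ?case by (intro exI[of _ 0]) simp
next
  case (pCons c S)
  then obtain H k where H: "\<And>u. u \<noteq> 0 \<Longrightarrow> poly H u = u ^ k * poly (poly S [:n / u:]) u" by blast
  have "poly (monom 1 (Suc k) * c + [:n:] * H) u = u ^ Suc k * poly (poly (pCons c S) [:n / u:]) u"
    if u: "u \<noteq> 0" for u
  proof -
    have "u ^ Suc k * poly (poly (pCons c S) [:n / u:]) u
        = u ^ Suc k * poly c u + (u * (n / u)) * (u ^ k * poly (poly S [:n / u:]) u)"
      by (simp add: distrib_left mult_ac del: times_divide_eq_right)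
    also have "\<dots> = u ^ Suc k * poly c u + n * poly H u"
      using u by (simp add: H)
    finally show ?thesis by (simp add: poly_monom)
  qed
  then show ?case by blast
qed

lemma fibre_polynomial:
  fixes S :: "real poly poly" and u :: real
  shows "\<exists>h. \<forall>v. poly h v = poly (poly S [:v:]) u"
proof (induction S)
  case 0
  show ?case by (intro exI[of _ 0]) simp
next
  case (pCons c S)
  then obtain h where h: "\<And>v. poly h v = poly (poly S [:v:]) u" by blast
  show ?case
    by (intro exI[of _ "[:poly c u:] + [:0,1:] * h"]) (simp add: h)
qed

lemma poly_eq_0_if_infinite_roots:
  fixes p :: "'a::idom poly"
  assumes "infinite A" "\<And>x. x \<in> A \<Longrightarrow> poly p x = 0"
  shows "p = 0"
  using assms poly_roots_finite[of p] by (metis (mono_tags) finite_subset mem_Collect_eq subsetI)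

text \<open>Roots are counted twice: along each hyperbola \<open>u v = n\<close>, where infinitely
many zeros force \<open>R\<close> to vanish on the whole curve, and then along each line of constant
\<open>u \<noteq> 0\<close>, which meets infinitely many of these curves.\<close>

lemma vanishes_on_infinitely_many_conics:
  fixes R :: "int poly poly" and a :: int
  assumes a: "a > 0" "sqrt (of_int a) \<notin> \<rat>"
    and inf: "infinite M"
    and pts: "\<And>n. n \<in> M \<Longrightarrow> infinite {(x, y). x\<^sup>2 - a * y\<^sup>2 = n \<and> poly (poly R [:y:]) x = 0}"
  shows "R = 0"
proof -
  define s where "s = sqrt (of_int a)"
  have s: "s \<noteq> 0" "s * s = of_int a" "s \<notin> \<rat>" using a by (auto simp: s_def)
  have uniq: "y = y' \<and> x = x'" if "real_of_int x + s * of_int y = of_int x' + s * of_int y'" for x y x' y'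
    using quadratic_coordinates_unique[OF s(3), of x y x' y'] that by (simp add: mult.commute)
  obtain S where S: "\<And>x y. poly (poly S [:of_int x - s * of_int y:]) (of_int x + s * of_int y) = of_int (poly (poly R [:y:]) x)"
    using bivariate_change_of_variables[OF s(1)] by blast
  have prod: "(real_of_int x - s * of_int y) * (of_int x + s * of_int y) = of_int (x\<^sup>2 - a * y\<^sup>2)" for x y
    by (simp add: algebra_simps power2_eq_square flip: s(2))
  have conic: "poly (poly S [:of_int n / u:]) u = 0" if n: "n \<in> M" and u: "u \<noteq> 0" for n u
  proof -
    obtain H k where H: "\<And>u. u \<noteq> 0 \<Longrightarrow> poly H u = u ^ k * poly (poly S [:of_int n / u:]) u"
      using hyperbola_restriction by blast
    let ?P = "{(x, y). x\<^sup>2 - a * y\<^sup>2 = n \<and> poly (poly R [:y:]) x = 0} - {(0, 0)}"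
    let ?f = "\<lambda>(x, y). real_of_int x + s * of_int y"
    have "inj_on ?f ?P" by (rule inj_onI) (auto dest: uniq)
    moreover have "infinite ?P" using pts[OF n] by simp
    ultimately have "infinite (?f ` ?P)" by (simp add: finite_image_iff)
    moreover have "poly H w = 0" if w: "w \<in> ?f ` ?P" for w
    proof -
      obtain x y where xy: "w = real_of_int x + s * of_int y" "x\<^sup>2 - a * y\<^sup>2 = n"
        "poly (poly R [:y:]) x = 0" "(x, y) \<noteq> (0, 0)" using w by auto
      have "w \<noteq> 0" using uniq[of x y 0 0] xy by auto
      then have "of_int n / w = real_of_int x - s * of_int y"
        using prod[of x y] xy by (simp add: field_simps)
      then show ?thesis using H[OF \<open>w \<noteq> 0\<close>] S[of x y] xy by simp
    qed
    ultimately have "H = 0" by (rule poly_eq_0_if_infinite_roots)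
    then show ?thesis using H[OF u] u by simp
  qed
  have S0: "poly (poly S [:v:]) u = 0" if u: "u \<noteq> 0" for u v
  proof -
    obtain h where h: "\<And>v. poly h v = poly (poly S [:v:]) u" using fibre_polynomial by blast
    have "infinite ((\<lambda>n. real_of_int n / u) ` M)"
      using inf u by (subst finite_image_iff) (auto intro!: inj_onI)
    then have "h = 0" by (rule poly_eq_0_if_infinite_roots) (auto simp: h conic u)
    then show ?thesis using h[of v] by simp
  qed
  have R0: "poly (poly R [:y:]) x = 0" if "x \<noteq> 0" for x y
  proof -
    have "real_of_int x + s * of_int y \<noteq> 0" using uniq[of x y 0 0] that by auto
    from S0[OF this] show ?thesis using S[of x y] by simp
  qed
  have infx: "infinite (- {0::int})" by (simp add: infinite_UNIV_char_0)
  have "poly R [:y:] = 0" for y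
    by (rule poly_eq_0_if_infinite_roots[OF infx]) (simp add: R0)
  moreover have "infinite (range (\<lambda>y::int. [:y:]))"
    by (simp add: finite_image_iff inj_on_def infinite_UNIV_char_0)
  ultimately show "R = 0" by (intro poly_eq_0_if_infinite_roots[of "range (\<lambda>y::int. [:y:])"]) auto
qed

section \<open>A divisibility criterion for density\<close>

definition conic_form :: "int \<Rightarrow> int poly poly" where
  "conic_form a = [:[:0, 0, 1:], 0, [:- a:]:]"

text \<open>The form \<open>x\<^sup>2 - a y\<^sup>2\<close> is coprime to \<open>y - 1\<close>
because its value \<open>x\<^sup>2 - a\<close> at \<open>y = 1\<close> is nonzero: a cofactor of
\<open>x\<^sup>2 - a y\<^sup>2\<close> in a multiple of \<open>y - 1\<close> must itself vanish at
\<open>y = 1\<close>.\<close>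

lemma conic_form_dvd_cancel:
  assumes "a > 0" "conic_form a dvd [:-1, 1:] * p"
  shows "conic_form a dvd p"
proof -
  obtain m where m: "[:-1, 1:] * p = conic_form a * m" using assms(2) by (elim dvdE)
  have "poly (conic_form a) 1 * poly m 1 = 0"
    using arg_cong[OF m, of "\<lambda>w. poly w 1"] by simp
  moreover have "poly (conic_form a) 1 \<noteq> 0" using assms(1) by (simp add: conic_form_def)
  ultimately have "[:-1, 1:] dvd m" by (simp add: poly_eq_0_iff_dvd)
  then obtain m' where "m = [:-1, 1:] * m'" by (elim dvdE)
  with m have "[:-1, 1:] * p = [:-1, 1:] * (conic_form a * m')" by (simp only: mult.left_commute)
  then have "p = conic_form a * m'" by (simp only: mult_cancel_left) simp
  then show ?thesis by simp
qed

text \<open>A substitute for Gauss's lemma on the primitive polynomial \<open>N t - b\<close>: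
comparing coefficients modulo \<open>N\<close> shows that \<open>N\<close> divides \<open>b
q\<close>, hence \<open>q\<close>, so one factor \<open>N\<close> can be removed at a time.\<close>

lemma cancel_leading_coefficient:
  fixes b N :: "'a::idom"
  assumes "N \<noteq> 0" and cop: "\<And>p. N dvd b * p \<Longrightarrow> N dvd p"
    and "smult (N ^ k) f = [:- b, N:] * q"
  shows "[:- b, N:] dvd f"
  using assms(3)
proof (induction k arbitrary: q)
  case 0
  then have "f = [:- b, N:] * q" by (simp only: power_0 smult_1_left)
  then show ?case by (simp only: dvd_triv_left)
next
  case (Suc k)
  have "N dvd b * coeff q i" for i
  proof -
    have "coeff ([:- b, N:] * q) i = - b * coeff q i + coeff (pCons 0 (smult N q)) i" by simp
    moreover have "N dvd coeff (pCons 0 (smult N q)) i" by (simp add: coeff_pCons split: nat.split)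
    moreover have "N dvd coeff ([:- b, N:] * q) i" unfolding Suc.prems[symmetric] by simp
    ultimately have "N dvd - b * coeff q i" using dvd_add_left_iff by metis
    then show ?thesis by simp
  qed
  then have "[:N:] dvd q" unfolding const_poly_dvd_iff using cop by blast
  then obtain q' where "q = [:N:] * q'" by (elim dvdE)
  then have "smult N (smult (N ^ k) f) = smult N ([:- b, N:] * q')" using Suc.prems by simp
  then have "smult (N ^ k) f = [:- b, N:] * q'" using assms(1) by (metis smult_cancel)
  then show ?case by (rule Suc.IH)
qed


text \<open>The remainder of the pseudo-division of \<open>f\<close> by \<open>F\<close> does not
involve \<open>t\<close>; it vanishes at the projections of the integral points and is therefore
zero.\<close>

lemma divisible_if_vanishing_on_integral_points:
  fixes a :: int and f :: poly3
  defines "F \<equiv> (X_var ^ 2 - of_int a * Y_var ^ 2) * T_var - (Y_var - 1)"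
  assumes a: "a > 0" "sqrt (of_int a) \<notin> \<rat>"
    and inf: "infinite {n. n \<noteq> 0 \<and> infinite {(x, y). x\<^sup>2 - a * y\<^sup>2 = n \<and> n dvd y - 1}}"
    and f: "\<And>z. z \<in> integral_points F \<Longrightarrow> eval3 f z = 0"
  shows "F dvd f"
proof -
  define N where "N = conic_form a"
  define b :: "int poly poly" where "b = [:- 1, 1:]"
  have F: "F = [:- b, N:]"
    by (simp add: F_def N_def b_def conic_form_def X_var_def Y_var_def T_var_def power2_eq_square of_int_poly one_pCons)
  obtain k q r where div: "smult (N ^ k) f = [:- b, N:] * q + [:r:]"
    using pseudo_division_by_linear by blast
  have "r = 0"
  proof (rule vanishes_on_infinitely_many_conics[OF a inf])
    fix n assume "n \<in> {n. n \<noteq> 0 \<and> infinite {(x, y). x\<^sup>2 - a * y\<^sup>2 = n \<and> n dvd y - 1}}"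
    then have n: "n \<noteq> 0" and i: "infinite {(x, y). x\<^sup>2 - a * y\<^sup>2 = n \<and> n dvd y - 1}" by auto
    have "poly (poly r [:y:]) x = 0" if xy: "x\<^sup>2 - a * y\<^sup>2 = n" "n dvd y - 1" for x y
    proof -
      obtain t where t: "y - 1 = n * t" using xy(2) by (elim dvdE)
      have F0: "eval3 F (x, y, t) = 0" using xy(1) t by (simp add: F_def)
      then have f0: "eval3 f (x, y, t) = 0" using f by (simp add: integral_points_def)
      have "eval3 (smult (N ^ k) f) (x, y, t) = 0" using f0 by (simp add: eval3_def)
      then have "eval3 [:r:] (x, y, t) = 0" unfolding div F[symmetric] using F0 by simp
      then show ?thesis by (simp add: eval3_def)
    qed
    then have "{(x, y). x\<^sup>2 - a * y\<^sup>2 = n \<and> n dvd y - 1} \<subseteq> {(x, y). x\<^sup>2 - a * y\<^sup>2 = n \<and> poly (poly r [:y:]) x = 0}"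
      by auto
    with i show "infinite {(x, y). x\<^sup>2 - a * y\<^sup>2 = n \<and> poly (poly r [:y:]) x = 0}"
      using infinite_super by blast
  qed
  with div have "smult (N ^ k) f = [:- b, N:] * q" by simp
  moreover have "N \<noteq> 0" by (simp add: N_def conic_form_def)
  moreover have "N dvd p" if "N dvd b * p" for p
    using that unfolding N_def b_def by (rule conic_form_dvd_cancel[OF a(1)])
  ultimately show ?thesis unfolding F by (rule cancel_leading_coefficient[rotated 2])
qed

lemma zero_in_spec_ZZ: "{0} \<in> spec ZZ_ring"
proof -
  interpret cring ZZ_ring by (rule cring_from_type_algebra)
  interpret domain ZZ_ring by unfold_locales (auto simp: ring_of_type_algebra_def)
  have "primeideal {\<zero>\<^bsub>ZZ_ring\<^esub>} ZZ_ring" by (rule zeroprimeideal)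
  then show ?thesis by (simp add: spec_def ring_of_type_algebra_def)
qed

text \<open>A basic open neighbourhood of a point \<open>P\<close> of the hypersurface is given by a
polynomial \<open>f\<close> outside \<open>P\<close>. As \<open>F\<close> lies in \<open>P\<close>,
it cannot divide \<open>f\<close>, so \<open>f\<close> is nonzero at some integral point, and the
generic point of that section of the hypersurface lies in the neighbourhood.\<close>

lemma zariski_dense_if_vanishing_implies_divisible:
  assumes "\<And>f. (\<And>z. z \<in> integral_points F \<Longrightarrow> eval3 f z = 0) \<Longrightarrow> F dvd f"
  shows "integral_points_zariski_dense F"
proof -
  let ?T = "zariski_topology poly3_ring" and ?S = "\<Union>z\<in>integral_points F. point_image z"
  have "zero_locus poly3_ring UNIV = {}"
    by (auto simp: zero_locus_def spec_def ring_of_type_algebra_def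
        dest!: primeideal.I_notcarr)
  then have "openin ?T (spec poly3_ring)"
    unfolding openin_zariski_topology by (intro exI[of _ UNIV]) (auto simp: ring_of_type_algebra_def)
  moreover have "topspace ?T \<subseteq> spec poly3_ring"
    using openin_topspace[of ?T] unfolding openin_zariski_topology by blast
  ultimately have top: "topspace ?T = spec poly3_ring" by (meson openin_subset subset_antisym)
  have "hypersurface F \<subseteq> ?T closure_of ?S"
  proof
    fix P assume P: "P \<in> hypersurface F"
    then have PF: "F \<in> P" "primeideal P poly3_ring" by (auto simp: hypersurface_def zero_locus_def spec_def)
    interpret primeideal P poly3_ring by (rule PF(2))
    show "P \<in> ?T closure_of ?S" unfolding in_closure_of top
    proof (intro conjI allI impI)
      show "P \<in> spec poly3_ring" using PF by (simp add: spec_def)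
      fix U assume "P \<in> U \<and> openin ?T U"
      then obtain A where A: "P \<in> U" "U = spec poly3_ring - zero_locus poly3_ring A"
        unfolding openin_zariski_topology by blast
      then obtain f where f: "f \<in> A" "f \<notin> P" using PF by (auto simp: zero_locus_def spec_def)
      have "\<not> F dvd f"
      proof
        assume "F dvd f"
        then obtain g where "f = F * g" by (elim dvdE)
        then show False using f I_r_closed[OF PF(1), of g] by (simp add: ring_of_type_algebra_def)
      qed
      then obtain z where z: "z \<in> integral_points F" "eval3 f z \<noteq> 0" using assms by blast
      let ?Q = "{g. eval3 g z \<in> {0}}"
      have "?Q \<in> point_image z" unfolding point_image_def using zero_in_spec_ZZ by blast
      moreover have "?Q \<in> spec poly3_ring"
        using point_image_subset_hypersurface[OF z(1)] calculation
        by (auto simp: hypersurface_def zero_locus_def)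
      moreover have "?Q \<notin> zero_locus poly3_ring A" using f z by (auto simp: zero_locus_def)
      ultimately show "\<exists>y. y \<in> ?S \<and> y \<in> U" using A z by blast
    qed
  qed
  moreover have "?S \<subseteq> hypersurface F" using point_image_subset_hypersurface by blast
  ultimately show ?thesis
    unfolding integral_points_zariski_dense_def closure_of_subtopology by (simp add: Int_absorb1 Int_absorb2)
qed

section \<open>Integers of a real quadratic field\<close>

lemma map_poly_of_int_add:
  "map_poly real_of_int (p + q) = map_poly real_of_int p + map_poly real_of_int q"
  by (rule poly_eqI) (simp add: coeff_map_poly)

lemma map_poly_of_int_smult:
  "map_poly real_of_int (smult c p) = smult (of_int c) (map_poly real_of_int p)"
  by (rule poly_eqI) (simp add: coeff_map_poly)

lemma map_poly_of_int_mult: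
  "map_poly real_of_int (p * q) = map_poly real_of_int p * map_poly real_of_int q"
  by (induction p) (simp_all add: map_poly_pCons map_poly_of_int_add map_poly_of_int_smult)

lemma algebraic_int_quadratic:
  fixes z :: real and T N :: int
  assumes "z * z = of_int T * z - of_int N"
  shows "algebraic_int z"
proof -
  have "poly (map_poly of_int [:N, - T, 1:]) z = 0" using assms by (simp add: map_poly_pCons algebra_simps)
  then show ?thesis unfolding algebraic_int_altdef_ipoly by (intro exI[of _ "[:N, - T, 1:]"]) simp
qed

text \<open>Gauss's lemma: contents are multiplicative, so \<open>k\<close> divides the cofactor
\<open>q\<close> and \<open>h\<close> divides the monic \<open>f\<close> itself.\<close>

lemma lead_coeff_primitive_divisor_of_monic:
  fixes f h q :: "int poly" and k :: int
  assumes "lead_coeff f = 1" "content h = 1" "k \<noteq> 0" "smult k f = h * q"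
  shows "is_unit (lead_coeff h)"
proof -
  have "k dvd content (smult k f)" by simp
  also have "content (smult k f) = content q" using assms(2,4) by (simp add: content_mult)
  finally have "[:k:] dvd q" by (simp add: const_poly_dvd_iff_dvd_content)
  then obtain q' where "q = [:k:] * q'" by (elim dvdE)
  with assms(4) have "smult k f = smult k (h * q')" by simp
  then have "f = h * q'" using assms(3) by (metis smult_cancel)
  then have "lead_coeff h * lead_coeff q' = 1" using assms(1) by (simp add: lead_coeff_mult)
  then show ?thesis by (metis dvd_triv_left)
qed

text \<open>The two divisibilities say that the trace \<open>2 m / d\<close> and the norm
\<open>(m\<^sup>2 - a n\<^sup>2) / d\<^sup>2\<close> of \<open>z\<close> are integers. They are read
off the quadratic polynomial of \<open>z\<close> after clearing denominators: its primitive part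
divides a multiple of a monic polynomial that kills \<open>z\<close> (the remainder is linear and
kills an irrational number), so it has leading coefficient \<open>\<plusminus>1\<close>, and
\<open>d\<^sup>2\<close> divides the content.\<close>

lemma trace_norm_integral:
  fixes z s :: real and a m n d :: int
  assumes s: "s * s = of_int a" "s \<notin> \<rat>" and nd: "n \<noteq> 0" "d > 0"
    and z: "algebraic_int z" "z = (of_int m + of_int n * s) / of_int d"
  shows "d dvd 2 * m \<and> d\<^sup>2 dvd m\<^sup>2 - a * n\<^sup>2"
proof -
  define h0 where "h0 = [:m\<^sup>2 - a * n\<^sup>2, - 2 * m * d, d\<^sup>2:]"
  define h where "h = primitive_part h0"
  have h0: "h0 = smult (content h0) h" by (simp add: h_def)
  have "h0 \<noteq> 0" using nd by (simp add: h0_def)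
  then have "content h = 1" and c0: "content h0 \<noteq> 0" by (auto simp: h_def)
  have zd: "of_int d * z = of_int m + of_int n * s" using z nd by simp
  have "(of_int d * z - of_int m)\<^sup>2 = (of_int n)\<^sup>2 * of_int a"
    unfolding zd by (simp add: power2_eq_square s(1) mult_ac flip: s(1))
  then have "poly (map_poly of_int h0) z = 0"
    by (simp add: h0_def map_poly_pCons power2_eq_square algebra_simps)
  then have hz: "poly (map_poly real_of_int h) z = 0"
    using c0 by (subst (asm) h0) (simp add: map_poly_of_int_smult)
  obtain f where f: "poly (map_poly of_int f) z = 0" "lead_coeff f = 1"
    using z(1) unfolding algebraic_int_altdef_ipoly by blast
  have "h \<noteq> 0" using \<open>h0 \<noteq> 0\<close> h0 by auto
  obtain k q where kq: "k \<noteq> 0" "smult k f = h * q + pseudo_mod f h"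
    using pseudo_mod(1)[OF \<open>h \<noteq> 0\<close>] by blast
  have "degree h = degree h0" by (simp add: h_def)
  then have deg: "degree h = 2" using nd by (simp add: h0_def)
  define r where "r = pseudo_mod f h"
  have "r = 0 \<or> degree r < 2" using pseudo_mod(2)[OF \<open>h \<noteq> 0\<close>, of f] deg by (simp add: r_def)
  then have "degree r < 2" by auto
  then have r: "r = [:coeff r 0, coeff r 1:]"
    by (intro poly_eqI) (auto simp: coeff_pCons coeff_eq_0 split: nat.split)
  have "poly (map_poly of_int (smult k f)) z = poly (map_poly real_of_int (h * q + r)) z"
    using kq by (simp add: r_def)
  then have "poly (map_poly real_of_int r) z = 0"
    using f hz by (simp add: map_poly_of_int_add map_poly_of_int_mult map_poly_of_int_smult map_poly_pCons)
  then have rz: "of_int (coeff r 0) + z * of_int (coeff r 1) = 0"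
    by (subst (asm) r) (simp add: map_poly_pCons)
  have zi: "z \<notin> \<rat>"
  proof
    assume "z \<in> \<rat>"
    moreover have "s = (of_int d * z - of_int m) / of_int n" using zd nd by simp
    ultimately show False using s(2) by simp
  qed
  have "coeff r 1 = 0"
  proof (rule ccontr)
    assume "coeff r 1 \<noteq> 0"
    then have "z = - of_int (coeff r 0) / of_int (coeff r 1)" using rz by (simp add: field_simps)
    then show False using zi by simp
  qed
  with rz r have "r = 0" by simp
  with kq have "smult k f = h * q" by (simp add: r_def)
  from lead_coeff_primitive_divisor_of_monic[OF f(2) \<open>content h = 1\<close> kq(1) this]
  have u: "is_unit (coeff h 2)" by (simp add: deg)
  have "d\<^sup>2 = content h0 * coeff h 2" using arg_cong[OF h0, of "\<lambda>w. coeff w 2"]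
    by (simp add: h0_def numeral_2_eq_2)
  then have "d\<^sup>2 dvd content h0" using u by (metis dvd_mult_unit_iff' dvd_refl mult.commute)
  then have c: "d\<^sup>2 dvd coeff h0 i" for i by (meson content_dvd_coeff dvd_trans)
  have "d * d dvd 2 * m * d" using c[of 1] by (simp add: h0_def power2_eq_square)
  then have "d dvd 2 * m" using nd by simp
  moreover have "d\<^sup>2 dvd m\<^sup>2 - a * n\<^sup>2" using c[of 0] by (simp add: h0_def)
  ultimately show ?thesis by blast
qed

lemma squarefree_square_dvd_cancel:
  fixes a d w :: int
  assumes "squarefree a" "d\<^sup>2 dvd a * w\<^sup>2" "d \<noteq> 0"
  shows "d dvd w"
proof -
  obtain d' w' where dw: "d = d' * gcd d w" "w = w' * gcd d w" "coprime d' w'"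
    using gcd_coprime_exists[of d w] assms(3) by auto
  define g where "g = gcd d w"
  have "g \<noteq> 0" using assms(3) by (simp add: g_def)
  have "(d' * g)\<^sup>2 dvd a * (w' * g)\<^sup>2" using assms(2) dw by (simp add: g_def)
  then have "g\<^sup>2 * d'\<^sup>2 dvd g\<^sup>2 * (a * w'\<^sup>2)" by (simp add: power_mult_distrib mult_ac)
  then have "d'\<^sup>2 dvd a * w'\<^sup>2" using \<open>g \<noteq> 0\<close> by simp
  then have "d'\<^sup>2 dvd a" using dw(3) by (simp add: coprime_dvd_mult_left_iff)
  then have "is_unit d'" using assms(1) by (auto simp: squarefree_def)
  then show ?thesis using dw(1,2) by (metis dvd_mult_unit_iff' dvd_triv_right mult.commute mult_unit_dvd_iff')
qed

text \<open>Trace \<open>A\<close> and norm \<open>(A\<^sup>2 - a B\<^sup>2) / 4\<close> of an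
integer are integral; then so is \<open>a B\<^sup>2\<close>, and since \<open>a\<close> is
square-free so is \<open>B\<close>. The statement includes \<open>a = 1\<close>, where the field is
\<open>\<rat>\<close> and coordinates are not unique: there \<open>B = 0\<close> can be
chosen.\<close>

lemma algebraic_int_in_quadratic_field_iff:
  fixes a :: int and z :: real
  assumes a: "a > 0" "squarefree a"
  shows "z \<in> quadratic_field a \<and> algebraic_int z \<longleftrightarrow>
    (\<exists>A B. z = (of_int A + of_int B * sqrt (of_int a)) / 2 \<and> 4 dvd A\<^sup>2 - a * B\<^sup>2)"
proof -
  define s where "s = sqrt (of_int a)"
  have s: "s * s = of_int a" using a by (simp add: s_def)
  have field: "quadratic_field a = {p + q * s | p q. p \<in> \<rat> \<and> q \<in> \<rat>}"
    unfolding s_def by (rule quadratic_field_eq[OF a(1)])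
  show ?thesis unfolding s_def[symmetric]
  proof
    assume "z \<in> quadratic_field a \<and> algebraic_int z"
    then obtain p q where pq: "z = p + q * s" "p \<in> \<rat>" "q \<in> \<rat>" and alg: "algebraic_int z"
      unfolding field by blast
    show "\<exists>A B. z = (of_int A + of_int B * s) / 2 \<and> 4 dvd A\<^sup>2 - a * B\<^sup>2"
    proof (cases "z \<in> \<rat>")
      case True
      then obtain k where "z = of_int k"
        using rational_algebraic_int_is_int[OF alg] by (auto elim: Ints_cases)
      then show ?thesis by (intro exI[of _ "2 * k"] exI[of _ 0]) simp
    next
      case False
      then have q0: "q \<noteq> 0" and sr: "s \<notin> \<rat>" using pq by auto
      obtain m1 d1 where p: "p = of_int m1 / of_int d1" "d1 > 0" using pq(2) by (auto elim!: Rats_cases')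
      obtain m2 d2 where q: "q = of_int m2 / of_int d2" "d2 > 0" using pq(3) by (auto elim!: Rats_cases')
      define m n d where "m = m1 * d2" and "n = m2 * d1" and "d = d1 * d2"
      have d: "d > 0" using p q by (simp add: d_def)
      have n: "n \<noteq> 0" using p q q0 by (auto simp: n_def)
      have z: "z = (of_int m + of_int n * s) / of_int d"
        unfolding pq(1) p(1) q(1) using p(2) q(2) by (simp add: m_def n_def d_def field_simps)
      obtain T N where T: "2 * m = d * T" and N: "m\<^sup>2 - a * n\<^sup>2 = d\<^sup>2 * N"
        using trace_norm_integral[OF s sr n d alg z] by (auto elim!: dvdE)
      have "(2 * m)\<^sup>2 - a * (2 * n)\<^sup>2 = 4 * (m\<^sup>2 - a * n\<^sup>2)" by (simp add: power2_eq_square algebra_simps)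
      then have disc: "a * (2 * n)\<^sup>2 = d\<^sup>2 * (T\<^sup>2 - 4 * N)"
        unfolding N T by (simp add: power2_eq_square algebra_simps)
      have "d dvd 2 * n"
        by (rule squarefree_square_dvd_cancel[OF a(2)]) (use disc d in auto)
      then obtain B where B: "2 * n = d * B" by (elim dvdE)
      have "d\<^sup>2 * (a * B\<^sup>2) = d\<^sup>2 * (T\<^sup>2 - 4 * N)" using disc unfolding B by (simp add: power_mult_distrib mult_ac)
      then have "T\<^sup>2 - a * B\<^sup>2 = 4 * N" using d by simp
      moreover have "z = (of_int T + of_int B * s) / 2"
      proof -
        have "of_int d * (of_int T + of_int B * s) = of_int (d * T) + of_int (d * B) * s" by (simp add: algebra_simps)
        also have "\<dots> = 2 * (of_int m + of_int n * s)" unfolding T[symmetric] B[symmetric] by simp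
        finally show ?thesis unfolding z using d by (simp add: field_simps)
      qed
      ultimately show ?thesis by (metis dvd_triv_left)
    qed
  next
    assume "\<exists>A B. z = (of_int A + of_int B * s) / 2 \<and> 4 dvd A\<^sup>2 - a * B\<^sup>2"
    then obtain A B N where AB: "z = (of_int A + of_int B * s) / 2" "A\<^sup>2 - a * B\<^sup>2 = 4 * N"
      by (auto elim!: dvdE)
    have "z = of_int A / 2 + (of_int B / 2) * s" using AB by (simp add: field_simps)
    then have "z \<in> quadratic_field a" unfolding field
      using Rats_divide Rats_of_int Rats_number_of by blast
    moreover have "algebraic_int z"
    proof (rule algebraic_int_quadratic)
      have "4 * real_of_int N = of_int A * of_int A - of_int B * of_int B * (s * s)"
        unfolding s using arg_cong[OF AB(2), of real_of_int] by (simp add: power2_eq_square mult_ac)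
      then show "z * z = of_int A * z - of_int N" unfolding AB(1) by (simp add: field_simps)
    qed
    ultimately show "z \<in> quadratic_field a \<and> algebraic_int z" by simp
  qed
qed

lemma square_mod_4: "x\<^sup>2 mod 4 = (if even x then 0 else 1)" for x :: int
proof (cases "even x")
  case True
  then show ?thesis by (auto elim!: evenE simp: power2_eq_square)
next
  case False
  then obtain k where "x = 2 * k + 1" by (elim oddE)
  then have "x\<^sup>2 - 1 = 4 * (k * k + k)" by (simp add: power2_eq_square algebra_simps)
  then have "4 dvd x\<^sup>2 - 1" by (simp only: dvd_triv_left)
  then have "x\<^sup>2 mod 4 = 1 mod 4" by (simp only: mod_eq_dvd_iff)
  then show ?thesis using False by simp
qed

lemma even_if_four_dvd_norm:
  fixes a A B :: int
  assumes "a mod 4 \<in> {2, 3}" "4 dvd A\<^sup>2 - a * B\<^sup>2"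
  shows "even A \<and> even B"
proof -
  have "A\<^sup>2 mod 4 = (a mod 4) * (B\<^sup>2 mod 4) mod 4"
    using assms(2) by (simp add: mod_eq_dvd_iff mod_mult_eq)
  then show ?thesis using assms(1) unfolding square_mod_4 by (auto split: if_splits)
qed

lemma carrier_ring_of_integers_eq:
  fixes a :: int
  assumes "a > 0" "squarefree a" "a mod 4 \<in> {2, 3}"
  shows "carrier (ring_of_integers (quadratic_field a)) = {of_int m + of_int n * sqrt (of_int a) | m n. True}"
proof -
  have "carrier (ring_of_integers (quadratic_field a)) =
    {z. \<exists>A B. z = (of_int A + of_int B * sqrt (of_int a)) / 2 \<and> 4 dvd A\<^sup>2 - a * B\<^sup>2}"
    using algebraic_int_in_quadratic_field_iff[OF assms(1,2)] by (simp add: ring_of_integers_def)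
  also have "\<dots> = {of_int m + of_int n * sqrt (of_int a) | m n. True}" (is "?X = ?Y")
  proof
    show "?X \<subseteq> ?Y"
    proof
      fix z assume "z \<in> ?X"
      then obtain A B where z: "z = (of_int A + of_int B * sqrt (of_int a)) / 2" "4 dvd A\<^sup>2 - a * B\<^sup>2" by blast
      then obtain m n where "A = 2 * m" "B = 2 * n" using even_if_four_dvd_norm[OF assms(3)] by (meson evenE)
      then have "z = of_int m + of_int n * sqrt (of_int a)" using z(1) by simp
      then show "z \<in> ?Y" by blast
    qed
    show "?Y \<subseteq> ?X"
    proof
      fix z assume "z \<in> ?Y"
      then obtain m n where z: "z = of_int m + of_int n * sqrt (of_int a)" by blast
      have "(2 * m)\<^sup>2 - a * (2 * n)\<^sup>2 = 4 * (m\<^sup>2 - a * n\<^sup>2)" by (simp add: power2_eq_square algebra_simps)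
      then have "4 dvd (2 * m)\<^sup>2 - a * (2 * n)\<^sup>2" by simp
      moreover have "z = (of_int (2 * m) + of_int (2 * n) * sqrt (of_int a)) / 2" using z by simp
      ultimately show "z \<in> ?X" by blast
    qed
  qed
  finally show ?thesis .
qed

text \<open>An integer congruent to \<open>2\<close> or \<open>3\<close> modulo \<open>4\<close> is
not a square.\<close>

lemma sqrt_irrational_if_mod_4:
  fixes a :: int
  assumes "a > 0" "a mod 4 \<in> {2, 3}"
  shows "sqrt (of_int a) \<notin> \<rat>"
proof
  assume "sqrt (of_int a) \<in> \<rat>"
  then have "sqrt (of_int a) \<in> \<int>" by (intro rational_algebraic_int_is_int) auto
  then obtain k where "sqrt (of_int a) = of_int k" by (elim Ints_cases)
  then have "real_of_int a = of_int (k\<^sup>2)" using assms(1) by (metis of_int_0_le_iff less_imp_le of_int_power real_sqrt_pow2)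
  then have "4 dvd k\<^sup>2 - a * 1\<^sup>2" by simp
  with even_if_four_dvd_norm[OF assms(2) this] show False by simp
qed

section \<open>Ramification at 2\<close>

text \<open>The ring of integers modulo \<open>2\<close> is reduced when \<open>a \<equiv> 1\<close>
modulo \<open>4\<close>. The square of \<open>z = (A + B s) / 2\<close> has
\<open>s\<close>-coordinate \<open>A B / 2\<close>; divisibility of the square by \<open>2\<close>
makes this integral, which forces both \<open>A\<close> and \<open>B\<close> to be even since they
have the same parity, and then comparing the rational parts gives \<open>A / 2 \<equiv> B /
2\<close> modulo \<open>2\<close>.\<close>

lemma half_algebraic_int_if_square_even:
  fixes a :: int and z :: real
  assumes a: "a > 0" "squarefree a" "a mod 4 = 1"
    and z: "z \<in> quadratic_field a" "algebraic_int z"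
    and sq: "z * z / 2 \<in> quadratic_field a" "algebraic_int (z * z / 2)"
  shows "z / 2 \<in> quadratic_field a \<and> algebraic_int (z / 2)"
proof -
  define s where "s = sqrt (of_int a)"
  have s: "s * s = of_int a" using a by (simp add: s_def)
  note O = algebraic_int_in_quadratic_field_iff[OF a(1,2), folded s_def]
  obtain A B where AB: "z = (of_int A + of_int B * s) / 2" "4 dvd A\<^sup>2 - a * B\<^sup>2"
    using O z by blast
  show ?thesis
  proof (cases "s \<in> \<rat>")
    case True
    then have "z \<in> \<rat>" unfolding AB(1) by simp
    then obtain k where k: "z = of_int k"
      using rational_algebraic_int_is_int[OF z(2)] by (auto elim: Ints_cases)
    have "z * z / 2 \<in> \<rat>" using \<open>z \<in> \<rat>\<close> by simp
    then obtain l where "z * z / 2 = of_int l"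
      using rational_algebraic_int_is_int[OF sq(2)] by (auto elim: Ints_cases)
    then have "of_int (k * k) = real_of_int (2 * l)" using k by simp
    then have "k * k = 2 * l" by (simp only: of_int_eq_iff)
    then have "even k" by (metis dvd_triv_left even_mult_iff)
    then obtain m where "k = 2 * m" by (elim evenE)
    then have "z / 2 = (of_int (2 * m) + of_int 0 * s) / 2" using k by simp
    moreover have "(4::int) dvd (2 * m)\<^sup>2 - a * 0\<^sup>2" by simp
    ultimately show ?thesis using O by blast
  next
    case False
    obtain A' B' where AB': "z * z / 2 = (of_int A' + of_int B' * s) / 2" "4 dvd A'\<^sup>2 - a * B'\<^sup>2"
      using O sq by blast
    have "(of_int A + of_int B * s) * (of_int A + of_int B * s) = 4 * (of_int A' + of_int B' * s)"
    proof -
      have "of_int A + of_int B * s = 2 * z" "of_int A' + of_int B' * s = z * z"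
        using AB(1) AB'(1) by simp_all
      then show ?thesis by simp
    qed
    moreover have "(of_int A + of_int B * s) * (of_int A + of_int B * s)
      = of_int A * of_int A + of_int B * of_int B * (s * s) + 2 * of_int A * of_int B * s"
      by (simp add: algebra_simps)
    ultimately have "of_int (A * A + a * (B * B)) + of_int (2 * A * B) * s = of_int (4 * A') + of_int (4 * B') * s"
      unfolding s by (simp add: mult_ac)
    from quadratic_coordinates_unique[OF False this]
    have eq: "A * A + a * (B * B) = 4 * A'" "A * B = 2 * B'" by auto
    have "odd a" using a(3) by presburger
    have "even (A\<^sup>2 - a * B\<^sup>2)" using AB(2) by (meson dvd_trans even_numeral)
    moreover have "even (A * B)" using eq(2) by simp
    ultimately have "even A" "even B" using \<open>odd a\<close> by auto
    then obtain m n where mn: "A = 2 * m" "B = 2 * n" by (meson evenE)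
    have A': "A' = m * m + a * (n * n)" and "B' = 2 * (m * n)" using eq unfolding mn by auto
    then have "even B'" by simp
    moreover have "even (A'\<^sup>2 - a * B'\<^sup>2)" using AB'(2) by (meson dvd_trans even_numeral)
    ultimately have "even A'" by simp
    then have par: "even m = even n" using A' \<open>odd a\<close> by simp
    have "m\<^sup>2 mod 4 = (a mod 4) * (n\<^sup>2 mod 4) mod 4"
      unfolding a(3) square_mod_4 using par by simp
    then have "4 dvd m\<^sup>2 - a * n\<^sup>2" by (simp add: mod_mult_eq mod_eq_dvd_iff)
    moreover have "z / 2 = (of_int m + of_int n * s) / 2" using AB(1) mn by simp
    ultimately show ?thesis using O by blast
  qed
qed

lemma ring_of_integers_simps:
  "x \<otimes>\<^bsub>ring_of_integers K\<^esub> y = x * y"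
  "x \<oplus>\<^bsub>ring_of_integers K\<^esub> y = x + y"
  "\<one>\<^bsub>ring_of_integers K\<^esub> = 1"
  "\<zero>\<^bsub>ring_of_integers K\<^esub> = 0"
  "x \<in> carrier (ring_of_integers K) \<longleftrightarrow> x \<in> K \<and> algebraic_int x"
  by (auto simp: ring_of_integers_def ring_of_type_algebra_def)

text \<open>Suppose \<open>a \<equiv> 1\<close> modulo \<open>4\<close> and \<open>(2) = P\<^sup>2
J\<close>. For \<open>x\<close> in \<open>P\<close> and \<open>y\<close> in \<open>J\<close> the
square of \<open>x y\<close> lies in \<open>P\<^sup>2 J = (2)\<close>; as \<open>\<O>/2\<close> is
reduced, \<open>x y\<close> is divisible by \<open>2\<close>. Therefore \<open>P\<^sup>2 J\<close>
is contained in \<open>2 P\<close>, and \<open>2\<close> in \<open>2 P\<close> gives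
\<open>1\<close> in \<open>P\<close>.\<close>

lemma ramified_at_2_imp_mod_4:
  fixes a :: int
  assumes a: "a > 0" "squarefree a" and ram: "ramified_at (quadratic_field a) 2"
  shows "a mod 4 \<in> {2, 3}"
proof -
  have "a mod 4 \<noteq> 0"
  proof
    assume "a mod 4 = 0"
    then have "2\<^sup>2 dvd a" by (simp add: dvd_eq_mod_eq_0)
    then have "is_unit (2::int)" using a(2) unfolding squarefree_def by blast
    then show False by simp
  qed
  moreover have "a mod 4 \<noteq> 1"
  proof
    assume a4: "a mod 4 = 1"
    define R where "R = ring_of_integers (quadratic_field a)"
    note simps = ring_of_integers_simps[where K = "quadratic_field a", folded R_def]
    obtain P J where P: "primeideal P R" and J: "ideal J R"
      and eq: "Idl\<^bsub>R\<^esub> {of_nat 2} = P \<cdot>\<^bsub>R\<^esub> P \<cdot>\<^bsub>R\<^esub> J"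
      using ram unfolding ramified_at_def R_def[symmetric] Let_def by blast
    interpret P: primeideal P R by (rule P)
    interpret J: ideal J R by (rule J)
    have one: "1 \<in> carrier R" using P.one_closed by (simp add: simps)
    have "1 + 1 \<in> carrier R" using P.add.m_closed[OF one one] by (simp add: simps(2))
    then have two: "(2::real) \<in> carrier R" by simp
    have Idl: "Idl\<^bsub>R\<^esub> {of_nat 2} = {x * 2 | x. x \<in> carrier R}"
      using P.cgenideal_eq_genideal[OF two] by (simp add: cgenideal_def simps(1))
    have PP: "ideal (P \<cdot>\<^bsub>R\<^esub> P) R" by (rule P.ideal_prod_is_ideal) (rule P.is_ideal)+
    have half: "\<exists>w \<in> carrier R. x * y = w * 2" if x: "x \<in> P" and y: "y \<in> J" for x y
    proof -
      have c: "x \<in> carrier R" "y \<in> carrier R" using P.Icarr J.Icarr x y by auto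
      have "x * x \<in> P \<cdot>\<^bsub>R\<^esub> P" using ideal_prod.prod[OF x x, of R] by (simp add: simps)
      moreover have "y * y \<in> J" using J.I_l_closed[OF y c(2)] by (simp add: simps(1))
      ultimately have "x * x * (y * y) \<in> P \<cdot>\<^bsub>R\<^esub> P \<cdot>\<^bsub>R\<^esub> J"
        using ideal_prod.prod[of "x * x" "P \<cdot>\<^bsub>R\<^esub> P" "y * y" J R] by (simp add: simps(1))
      then obtain w where w: "x * x * (y * y) = w * 2" "w \<in> carrier R" unfolding eq[symmetric] Idl by blast
      have "(x * y) * (x * y) / 2 = w" using w(1) by (simp add: mult_ac)
      moreover have "x * y \<in> carrier R" using P.m_closed[OF c] by (simp add: simps(1))
      ultimately have "x * y / 2 \<in> carrier R"
        using half_algebraic_int_if_square_even[OF a a4, of "x * y"] w(2) by (simp add: simps(5))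
      then show ?thesis by (intro bexI[of _ "x * y / 2"]) simp_all
    qed
    have even_sum: "\<exists>w \<in> P. u + v = w * 2" if uv: "\<exists>w \<in> P. u = w * 2" "\<exists>w \<in> P. v = w * 2" for u v
    proof -
      obtain w where w: "w \<in> P" "u = w * 2" using uv(1) by (elim bexE)
      obtain w' where w': "w' \<in> P" "v = w' * 2" using uv(2) by (elim bexE)
      have "u + v = (w + w') * 2" unfolding w(2) w'(2) by (rule distrib_right[symmetric])
      moreover have "w + w' \<in> P" using additive_subgroup.a_closed[OF P.additive_subgroup_axioms, OF w(1) w'(1)] by (simp add: simps(2))
      ultimately show ?thesis by (rule bexI)
    qed
    have PPJ: "\<exists>w \<in> P. q * y = w * 2" if "q \<in> P \<cdot>\<^bsub>R\<^esub> P" and y: "y \<in> J" for q y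
      using that(1)
    proof induction
      case (prod i j)
      obtain w where w: "w \<in> carrier R" "j * y = w * 2" using half[OF prod(2) y] by blast
      have "i * w \<in> P" using P.I_r_closed[OF prod(1) w(1)] by (simp add: simps(1))
      moreover have "i * j * y = i * w * 2" using w(2) by simp
      ultimately show ?case unfolding simps(1) by (rule rev_bexI)
    next
      case (sum s1 s2)
      then show ?case using even_sum[of "s1 * y" "s2 * y"] by (simp add: simps(2) distrib_right)
    qed
    have "2 \<in> P \<cdot>\<^bsub>R\<^esub> P \<cdot>\<^bsub>R\<^esub> J" unfolding eq[symmetric] Idl using one by force
    moreover have "\<exists>w \<in> P. t = w * 2" if "t \<in> P \<cdot>\<^bsub>R\<^esub> P \<cdot>\<^bsub>R\<^esub> J" for t
      using that
    proof induction
      case (prod i j)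
      then show ?case using PPJ by (simp add: simps(1))
    next
      case (sum s1 s2)
      then show ?case using even_sum by (simp add: simps(2))
    qed
    ultimately have "1 \<in> P" by fastforce
    then show False using P.one_imp_carrier P.I_notcarr by (simp add: simps(3))
  qed
  ultimately show ?thesis using pos_mod_bound[of 4 a] pos_mod_sign[of 4 a] by simp linarith
qed

section \<open>Degree-one primes and their generators\<close>

definition congruence_lattice :: "real \<Rightarrow> int \<Rightarrow> int \<Rightarrow> real set" where
  "congruence_lattice s p r = {of_int m + of_int n * s | m n. p dvd m + n * r}"

lemma additive_mod_eq_mult:
  fixes g :: "int \<Rightarrow> int" and p :: int
  assumes add: "\<And>x y. [g (x + y) = g x + g y] (mod p)"
  shows "[g m = m * g 1] (mod p)"
proof (induction m rule: int_induct[where k = 0])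
  case base
  show ?case using cong_diff[OF add[of 0 0] cong_refl[of "g 0"]] by (simp add: cong_sym_eq)
next
  case (step1 i)
  from cong_trans[OF add[of i 1] cong_add[OF step1(2) cong_refl]] show ?case by (simp add: algebra_simps)
next
  case (step2 i)
  have "[g i = g (i - 1) + g 1] (mod p)" using add[of "i - 1" 1] by simp
  then have "[g (i - 1) + g 1 = i * g 1] (mod p)" using step2(2) by (metis cong_trans cong_sym)
  from cong_diff[OF this cong_refl[of "g 1"]] show ?case by (simp add: algebra_simps)
qed

text \<open>The residue map to \<open>\<int>/p\<close> is determined by the image \<open>r\<close>
of \<open>\<surd>a\<close>, so its kernel is the lattice of all \<open>m + n \<surd>a\<close> with
\<open>m + n r \<equiv> 0\<close>. In particular only finitely many degree-one primes lie over each
\<open>p\<close>.\<close>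

lemma degree_one_prime_eq_congruence_lattice:
  fixes a :: int
  defines "R \<equiv> ring_of_integers (quadratic_field a)" and "s \<equiv> sqrt (of_int a)"
  assumes a: "a > 0" and s: "s \<notin> \<rat>"
    and O: "carrier R = {of_int m + of_int n * s | m n. True}"
    and P: "degree_one_prime (quadratic_field a) P"
  shows "\<exists>p r. Factorial_Ring.prime p \<and> r \<in> {0..<p} \<and> p dvd r\<^sup>2 - a \<and> P = congruence_lattice s p r"
proof -
  note simps = ring_of_integers_simps[where K = "quadratic_field a", folded R_def]
  have ss: "s * s = of_int a" using a by (simp add: s_def)
  obtain q :: nat and h where q: "Factorial_Ring.prime q" and prm: "primeideal P R"
    and h: "h \<in> ring_iso (R Quot P) (residue_ring (int q))"
    using P unfolding degree_one_prime_def R_def[symmetric] is_ring_iso_def by blast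
  interpret P: primeideal P R by (rule prm)
  define p where "p = int q"
  have p: "Factorial_Ring.prime p" using q by (simp add: p_def)
  have p1: "p > 1" using prime_gt_1_int[OF p] .
  define g where "g = h \<circ> (+>\<^bsub>R\<^esub>) P"
  have g: "g \<in> ring_hom R (residue_ring p)"
    unfolding g_def p_def using ring_hom_trans[OF P.rcos_ring_hom] h by (auto simp: ring_iso_def)
  have inR: "of_int m + of_int n * s \<in> carrier R" for m n unfolding O by blast
  have inR': "of_int m \<in> carrier R" "of_int n * s \<in> carrier R" "s \<in> carrier R" for m n
    using inR[of m 0] inR[of 0 n] inR[of 0 1] by simp_all
  have gadd: "[g (x + y) = g x + g y] (mod p)" if "x \<in> carrier R" "y \<in> carrier R" for x y
    using ring_hom_add[OF g that] by (simp add: simps residue_ring_def cong_def)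
  have gmult: "[g (x * y) = g x * g y] (mod p)" if "x \<in> carrier R" "y \<in> carrier R" for x y
    using ring_hom_mult[OF g that] by (simp add: simps residue_ring_def cong_def)
  have g1: "g 1 = 1" using ring_hom_one[OF g] p1 by (simp add: simps residue_ring_def)
  have range: "g x \<in> {0..<p}" if "x \<in> carrier R" for x
    using ring_hom_closed[OF g that] by (auto simp: residue_ring_def)
  define r where "r = g s"
  have gm: "[g (of_int m) = m] (mod p)" for m
    using additive_mod_eq_mult[of "\<lambda>m. g (of_int m)" p m] gadd[OF inR'(1) inR'(1)] by (simp add: g1)
  have gn: "[g (of_int n * s) = n * r] (mod p)" for n
    using additive_mod_eq_mult[of "\<lambda>n. g (of_int n * s)" p n] gadd[OF inR'(2) inR'(2)]
    by (simp add: r_def distrib_right)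
  have gmn: "[g (of_int m + of_int n * s) = m + n * r] (mod p)" for m n
    using cong_trans[OF gadd[OF inR'(1,2)] cong_add[OF gm gn]] .
  have "[a = r * r] (mod p)"
    using cong_trans[OF cong_sym[OF gm[of a]]] gmult[OF inR'(3) inR'(3)] by (simp add: ss r_def)
  then have "p dvd r\<^sup>2 - a" by (metis cong_iff_dvd_diff cong_sym power2_eq_square)
  have ker: "x \<in> P \<longleftrightarrow> g x = 0" if x: "x \<in> carrier R" for x
  proof -
    have z: "0 \<in> carrier R" using inR'(1)[of 0] by simp
    have "x \<ominus>\<^bsub>R\<^esub> 0 = x" using P.minus_eq x P.r_zero P.minus_zero by (simp add: simps(4)[symmetric])
    then have "x \<in> P \<longleftrightarrow> P +>\<^bsub>R\<^esub> x = P +>\<^bsub>R\<^esub> 0"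
      using P.quotient_eq_iff_same_a_r_cos[OF P.is_ideal x z] by simp
    also have "\<dots> \<longleftrightarrow> h (P +>\<^bsub>R\<^esub> x) = h (P +>\<^bsub>R\<^esub> 0)"
    proof -
      have "inj_on h (carrier (R Quot P))" using h by (auto simp: ring_iso_def bij_betw_def)
      moreover have "P +>\<^bsub>R\<^esub> x \<in> carrier (R Quot P)" "P +>\<^bsub>R\<^esub> 0 \<in> carrier (R Quot P)"
        using ring_hom_closed[OF P.rcos_ring_hom] x z by blast+
      ultimately show ?thesis by (auto dest: inj_onD)
    qed
    also have "\<dots> \<longleftrightarrow> g x = g 0" by (simp add: g_def)
    also have "g 0 = 0" using gm[of 0] range[OF z] by (simp add: cong_def)
    finally show ?thesis .
  qed
  have "P = congruence_lattice s p r"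
  proof -
    have "of_int m + of_int n * s \<in> P \<longleftrightarrow> p dvd m + n * r" for m n
    proof -
      have "of_int m + of_int n * s \<in> P \<longleftrightarrow> g (of_int m + of_int n * s) mod p = 0"
        using ker[OF inR] range[OF inR, of m n] by (simp add: mod_pos_pos_trivial)
      also have "\<dots> \<longleftrightarrow> p dvd m + n * r" using gmn[of m n] by (simp add: cong_def dvd_eq_mod_eq_0)
      finally show ?thesis .
    qed
    moreover have "\<exists>m n. x = of_int m + of_int n * s" if "x \<in> P" for x
      using P.Icarr[OF that] unfolding O by blast
    ultimately show ?thesis unfolding congruence_lattice_def by blast
  qed
  then show ?thesis using p \<open>p dvd r\<^sup>2 - a\<close> range[OF inR'(3)] unfolding r_def by blast
qed

text \<open>If the quotient by the principal ideals \<open>H\<close> has one element, the coset of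
\<open>P\<close> is \<open>H\<close>; it contains \<open>\<O> P = P\<close> because
\<open>\<O>\<close> itself lies in \<open>H\<close>.\<close>

lemma ideal_principal_if_class_group_trivial:
  fixes K :: "real set"
  defines "R \<equiv> ring_of_integers K"
  assumes cl: "trivial_group (class_group K)" and P: "ideal P R" "P \<noteq> {0}" and K1: "1 \<in> K"
  shows "\<exists>c \<in> carrier R. P = (\<lambda>x. c * x) ` carrier R"
proof -
  note simps = ring_of_integers_simps[where K = K, folded R_def]
  interpret P: ideal P R by (rule P(1))
  let ?H = "principal_fractional_ideals K" and ?G = "fractional_ideal_group K"
  have one: "1 \<in> carrier R" using P.one_closed by (simp add: simps)
  have neg: "\<ominus>\<^bsub>R\<^esub> 1 = - 1" using P.r_neg[OF one] by (simp add: simps)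
  have diff: "x - y \<in> P" if "x \<in> P" "y \<in> P" for x y
  proof -
    have "\<ominus>\<^bsub>R\<^esub> 1 \<otimes>\<^bsub>R\<^esub> y \<in> P" using P.I_l_closed that(2) one by simp
    then have "- y \<in> P" by (simp add: neg simps)
    then show ?thesis using additive_subgroup.a_closed[OF P.additive_subgroup_axioms that(1), of "- y"] by (simp add: simps(2))
  qed
  have "0 \<in> P" using additive_subgroup.zero_closed[OF P.additive_subgroup_axioms] by (simp add: simps)
  have "P \<in> fractional_ideals K"
    unfolding fractional_ideals_def Let_def R_def[symmetric] mem_Collect_eq
  proof (intro conjI ballI)
    show "P \<subseteq> K" using P.Icarr by (auto simp: simps)
    show "r * x \<in> P" if "r \<in> carrier R" "x \<in> P" for r x
      using P.I_l_closed[OF that(2,1)] by (simp add: simps)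
    show "\<exists>d\<in>carrier R - {0}. \<forall>x\<in>P. d * x \<in> carrier R"
      using one P.Icarr by (intro bexI[of _ 1]) auto
  qed (use diff \<open>0 \<in> P\<close> P(2) in auto)
  then have "?H #>\<^bsub>?G\<^esub> P \<in> carrier (class_group K)"
    unfolding class_group_def FactGroup_def RCOSETS_def by (auto simp: fractional_ideal_group_def)
  then have "?H #>\<^bsub>?G\<^esub> P = ?H"
    using cl by (auto simp: trivial_group_def class_group_def FactGroup_def)
  moreover have "carrier R \<in> ?H"
    unfolding principal_fractional_ideals_def R_def[symmetric] using K1 by (auto intro!: exI[of _ 1])
  then have "ideal_prod real_ring (carrier R) P \<in> ?H #>\<^bsub>?G\<^esub> P"
    by (auto simp: r_coset_def fractional_ideal_group_def)
  moreover have "ideal_prod real_ring (carrier R) P = P"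
  proof
    show "ideal_prod real_ring (carrier R) P \<subseteq> P"
    proof
      fix x assume "x \<in> ideal_prod real_ring (carrier R) P"
      then show "x \<in> P"
      proof induction
        case (prod i j)
        then show ?case using P.I_l_closed[of j i] by (simp add: simps ring_of_type_algebra_def)
      next
        case (sum u v)
        then show ?case using additive_subgroup.a_closed[OF P.additive_subgroup_axioms, of u v] by (simp add: simps(2) ring_of_type_algebra_def)
      qed
    qed
    show "P \<subseteq> ideal_prod real_ring (carrier R) P"
      using ideal_prod.prod[OF one, of _ P real_ring] by (auto simp: ring_of_type_algebra_def)
  qed
  ultimately have "P \<in> ?H" by simp
  then obtain c where c: "P = (\<lambda>x. c * x) ` carrier R"
    unfolding principal_fractional_ideals_def R_def[symmetric] by blast
  moreover have "c \<in> P" unfolding c using one by force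
  ultimately show ?thesis using P.Icarr by blast
qed

text \<open>A number \<open>d\<close> prime to \<open>p\<close> represents a unit of the residue
ring, so some unit of \<open>\<int>[s]\<close> has the same class; having an inverse in
\<open>\<int>[s]\<close>, its norm is \<open>\<plusminus>1\<close>.\<close>

lemma unit_in_residue_class:
  fixes a :: int
  defines "R \<equiv> ring_of_integers (quadratic_field a)" and "s \<equiv> sqrt (of_int a)"
  assumes a: "a > 0" and s: "s \<notin> \<rat>"
    and O: "carrier R = {of_int m + of_int n * s | m n. True}"
    and P: "ideal P R" "P = congruence_lattice s p r" "Factorial_Ring.prime p"
    and surj: "unit_reduction_surjective (quadratic_field a) P"
    and d: "\<not> p dvd d"
  shows "\<exists>e f. \<bar>e\<^sup>2 - a * f\<^sup>2\<bar> = 1 \<and> p dvd e + f * r - d"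
proof -
  note simps = ring_of_integers_simps[where K = "quadratic_field a", folded R_def]
  have ss: "s * s = of_int a" using a by (simp add: s_def)
  interpret P: ideal P R by (rule P(1))
  have inR: "of_int m + of_int n * s \<in> carrier R" for m n unfolding O by blast
  have inR': "of_int m \<in> carrier R" for m using inR[of m 0] by simp
  have minus: "x \<ominus>\<^bsub>R\<^esub> y = x - y" if "x \<in> carrier R" "y \<in> carrier R" for x y
  proof -
    have "y + \<ominus>\<^bsub>R\<^esub> y = 0" using P.r_neg[OF that(2)] by (simp add: simps)
    then show ?thesis using P.minus_eq[of x y] by (simp add: simps)
  qed
  have memP: "of_int m + of_int n * s \<in> P \<longleftrightarrow> p dvd m + n * r" for m n
    unfolding P(2) congruence_lattice_def using quadratic_coordinates_unique[OF s] by blast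
  have "coprime d p" using prime_imp_coprime[OF P(3) d] by (simp add: coprime_commute)
  then obtain d' where d': "[d * d' = 1] (mod p)" using cong_solve_coprime_int by blast
  have "P +>\<^bsub>R\<^esub> of_int d \<in> Units (R Quot P)"
  proof -
    have "p dvd (d * d' - 1) + 0 * r" using d' by (simp add: cong_iff_dvd_diff)
    then have "of_int (d * d' - 1) + of_int 0 * s \<in> P" using memP by blast
    then have "of_int (d * d') \<ominus>\<^bsub>R\<^esub> of_int 1 \<in> P" unfolding minus[OF inR' inR'] by simp
    then have "P +>\<^bsub>R\<^esub> of_int (d * d') = P +>\<^bsub>R\<^esub> of_int 1"
      using P.quotient_eq_iff_same_a_r_cos[OF P.is_ideal inR' inR'] by blast
    then have e: "(P +>\<^bsub>R\<^esub> of_int d) \<otimes>\<^bsub>R Quot P\<^esub> (P +>\<^bsub>R\<^esub> of_int d') = \<one>\<^bsub>R Quot P\<^esub>"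
      "(P +>\<^bsub>R\<^esub> of_int d') \<otimes>\<^bsub>R Quot P\<^esub> (P +>\<^bsub>R\<^esub> of_int d) = \<one>\<^bsub>R Quot P\<^esub>"
      using P.rcoset_mult_add[OF inR'[of d] inR'[of d']] P.rcoset_mult_add[OF inR'[of d'] inR'[of d]]
      by (simp_all add: FactRing_def simps mult.commute)
    then show ?thesis unfolding Units_def using ring_hom_closed[OF P.rcos_ring_hom inR'] by blast
  qed
  then obtain u where u: "u \<in> Units R" "P +>\<^bsub>R\<^esub> u = P +>\<^bsub>R\<^esub> of_int d"
    using surj unfolding unit_reduction_surjective_def R_def[symmetric] Let_def by (metis (no_types, lifting) imageE)
  then obtain v where v: "u \<in> carrier R" "v \<in> carrier R" "u * v = 1" by (auto simp: Units_def simps(1,3))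
  obtain e f where ef: "u = of_int e + of_int f * s" using v(1) unfolding O by blast
  obtain e' f' where ef': "v = of_int e' + of_int f' * s" using v(2) unfolding O by blast
  have "u * v = of_int (e * e' + a * f * f') + of_int (e * f' + f * e') * s"
    unfolding ef ef' by (simp add: algebra_simps ss[symmetric])
  then have "of_int (e * e' + a * f * f') + of_int (e * f' + f * e') * s = of_int 1 + of_int 0 * s" using v(3) by simp
  from quadratic_coordinates_unique[OF s this]
  have e1: "e * e' + a * f * f' = 1" "e * f' + f * e' = 0" by auto
  have "(e\<^sup>2 - a * f\<^sup>2) * (e'\<^sup>2 - a * f'\<^sup>2) = (e * e' + a * f * f')\<^sup>2 - a * (e * f' + f * e')\<^sup>2"
    by (simp add: power2_eq_square algebra_simps)
  also have "\<dots> = 1" using e1 by simp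
  finally have "\<bar>e\<^sup>2 - a * f\<^sup>2\<bar> = 1" using zmult_eq_1_iff by fastforce
  have "u \<ominus>\<^bsub>R\<^esub> of_int d \<in> P"
    using P.quotient_eq_iff_same_a_r_cos[OF P.is_ideal v(1) inR'] u(2) by blast
  then have "u - of_int d \<in> P" unfolding minus[OF v(1) inR'] .
  moreover have "u - of_int d = of_int (e - d) + of_int f * s" using ef by simp
  ultimately have "of_int (e - d) + of_int f * s \<in> P" by (simp only:)
  then have "p dvd e + f * r - d" unfolding memP by (simp add: algebra_simps)
  then show ?thesis using \<open>\<bar>e\<^sup>2 - a * f\<^sup>2\<bar> = 1\<close> by blast
qed

section \<open>Points on conics from units\<close>

lemma fermat_little_int:
  fixes p w :: int
  assumes "Factorial_Ring.prime p" "\<not> p dvd w"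
  shows "[w ^ (nat p - 1) = 1] (mod p)"
proof -
  have p: "p > 0" using prime_gt_0_int[OF assms(1)] .
  define v where "v = nat (w mod p)"
  have v: "int v = w mod p" using p by (simp add: v_def)
  have "\<not> nat p dvd v"
    using assms(2) p v by (metis dvd_mod_iff dvd_refl int_dvd_int_iff int_nat_eq less_imp_le)
  then have "[v ^ (nat p - 1) = 1] (mod nat p)"
    using fermat_theorem[of "nat p" v] assms(1) by simp
  then have "[int (v ^ (nat p - 1)) = int 1] (mod int (nat p))" by (simp only: cong_int_iff)
  then have "[(w mod p) ^ (nat p - 1) = 1] (mod p)" using p v by simp
  then show ?thesis by (simp add: cong_def power_mod)
qed

text \<open>Reduction \<open>s \<mapsto> r\<close> modulo \<open>p\<close> is multiplicative on
\<open>\<int>[s]\<close>, so the residue of a power is the power of the residue.\<close>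

lemma pell_powers:
  fixes a E F p r :: int and s :: real
  assumes "s * s = of_int a" "E\<^sup>2 - a * F\<^sup>2 = 1" "p dvd r\<^sup>2 - a"
  shows "\<exists>e f. (of_int E + of_int F * s) ^ k = of_int e + of_int f * s \<and> e\<^sup>2 - a * f\<^sup>2 = 1 \<and>
    [e + f * r = (E + F * r) ^ k] (mod p)"
proof (induction k)
  case 0
  show ?case by (intro exI[of _ 1] exI[of _ 0]) simp
next
  case (Suc k)
  then obtain e f where ef: "(of_int E + of_int F * s) ^ k = of_int e + of_int f * s"
    "e\<^sup>2 - a * f\<^sup>2 = 1" "[e + f * r = (E + F * r) ^ k] (mod p)" by blast
  define e' f' where "e' = e * E + a * f * F" and "f' = e * F + f * E"
  have "(of_int E + of_int F * s) ^ Suc k = of_int e' + of_int f' * s"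
    unfolding power_Suc ef(1) by (simp add: e'_def f'_def algebra_simps assms(1)[symmetric])
  moreover have "e'\<^sup>2 - a * f'\<^sup>2 = (e\<^sup>2 - a * f\<^sup>2) * (E\<^sup>2 - a * F\<^sup>2)"
    by (simp add: e'_def f'_def power2_eq_square algebra_simps)
  moreover have "[e' + f' * r = (E + F * r) ^ Suc k] (mod p)"
  proof -
    have "(E + F * r) * (e + f * r) - (e' + f' * r) = (r\<^sup>2 - a) * (f * F)"
      by (simp add: e'_def f'_def power2_eq_square algebra_simps)
    then have "[(E + F * r) * (e + f * r) = e' + f' * r] (mod p)"
      using assms(3) by (metis cong_iff_dvd_diff dvd_mult2)
    then show ?thesis using cong_mult[OF cong_refl ef(3), of "E + F * r"]
      by (metis cong_sym cong_trans power_Suc)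
  qed
  ultimately show ?case using ef(2) assms(2) by (metis mult_1)
qed

text \<open>Let \<open>\<epsilon> = E + F \<surd>a\<close> be a unit of norm one other than
\<open>\<plusminus>1\<close>. By Fermat its powers with exponent divisible by \<open>p - 1\<close>
reduce to \<open>1\<close>, and so do their conjugates; multiplying the given point by them changes
neither the norm nor \<open>y\<close> modulo \<open>p\<close>.\<close>

lemma infinitely_many_points_on_conic:
  fixes a p r n x0 y0 E F :: int
  assumes a: "a > 0" "sqrt (of_int a) \<notin> \<rat>"
    and p: "Factorial_Ring.prime p" "p dvd r\<^sup>2 - a" and n: "n \<noteq> 0" "n dvd p"
    and pt: "x0\<^sup>2 - a * y0\<^sup>2 = n" "p dvd x0 + y0 * r" "[y0 = 1] (mod p)"
    and EF: "E\<^sup>2 - a * F\<^sup>2 = 1" "F \<noteq> 0"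
  shows "infinite {(x, y). x\<^sup>2 - a * y\<^sup>2 = n \<and> n dvd y - 1}"
proof -
  define s where "s = sqrt (of_int a)"
  have s: "s * s = of_int a" "s \<notin> \<rat>" using a by (auto simp: s_def)
  define \<epsilon> where "\<epsilon> = of_int E + of_int F * s"
  have ne: "\<epsilon> \<noteq> of_int c" for c
    using quadratic_coordinates_unique[OF s(2), of E F c 0] EF(2) by (auto simp: \<epsilon>_def)
  have \<epsilon>: "\<epsilon> \<noteq> 0" "\<bar>\<epsilon>\<bar> \<noteq> 1" using ne[of 0] ne[of 1] ne[of "-1"] by auto
  define m where "m = nat p - 1"
  have m: "m > 0" using prime_gt_1_int[OF p(1)] by (simp add: m_def)
  define w where "w = of_int x0 + of_int y0 * s"
  have w: "w \<noteq> 0"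
    using quadratic_coordinates_unique[OF s(2), of x0 y0 0 0] pt(1) n(1) by (auto simp: w_def)
  \<comment> \<open>The residue of a unit and that of its conjugate have product \<open>1\<close>; so the residue is prime to \<open>p\<close>.\<close>
  have "(E + F * r) * (E - F * r) - 1 = - (r\<^sup>2 - a) * F\<^sup>2"
    using EF(1) by (simp add: power2_eq_square algebra_simps)
  then have "p dvd (E + F * r) * (E - F * r) - 1" using p(2) by (metis dvd_minus_iff dvd_mult2)
  then have "\<not> p dvd E + F * r"
    using p(1) by (metis dvd_add_right_iff dvd_mult2 diff_add_cancel not_prime_unit)
  then have fermat: "[(E + F * r) ^ m = 1] (mod p)" unfolding m_def by (rule fermat_little_int[OF p(1)])
  let ?X = "{(x, y). x\<^sup>2 - a * y\<^sup>2 = n \<and> n dvd y - 1}" and ?f = "\<lambda>(x, y). real_of_int x + of_int y * s"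
  have "w * \<epsilon> ^ (m * k) \<in> ?f ` ?X" for k
  proof -
    obtain e f where ef: "\<epsilon> ^ (m * k) = of_int e + of_int f * s" "e\<^sup>2 - a * f\<^sup>2 = 1"
      "[e + f * r = (E + F * r) ^ (m * k)] (mod p)"
      using pell_powers[OF s(1) EF(1) p(2)] unfolding \<epsilon>_def by blast
    have e1: "[e + f * r = 1] (mod p)"
      using cong_trans[OF ef(3)] cong_pow[OF fermat, of k] by (simp add: power_mult)
    have "(e + f * r) * (e - f * r) - 1 = - (r\<^sup>2 - a) * f\<^sup>2"
      using ef(2) by (simp add: power2_eq_square algebra_simps)
    then have "[(e + f * r) * (e - f * r) = 1] (mod p)" using p(2) by (metis cong_iff_dvd_diff dvd_minus_iff dvd_mult2)
    moreover have "[(e + f * r) * (e - f * r) = 1 * (e - f * r)] (mod p)" using e1 by (rule cong_mult) simp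
    ultimately have e2: "[e - f * r = 1] (mod p)" by (metis cong_sym cong_trans mult_1)
    define x y where "x = x0 * e + a * y0 * f" and "y = x0 * f + y0 * e"
    have "[(x0 + y0 * r) * f + y0 * (e - f * r) = 0 * f + 1 * 1] (mod p)"
      using pt(2,3) e2 by (intro cong_add cong_mult) (auto simp: cong_0_iff)
    then have "[y = 1] (mod p)" by (simp add: y_def algebra_simps)
    then have "n dvd y - 1" using n(2) by (metis cong_iff_dvd_diff dvd_trans)
    moreover have "x\<^sup>2 - a * y\<^sup>2 = (x0\<^sup>2 - a * y0\<^sup>2) * (e\<^sup>2 - a * f\<^sup>2)"
      by (simp add: x_def y_def power2_eq_square algebra_simps)
    then have "x\<^sup>2 - a * y\<^sup>2 = n" using pt(1) ef(2) by simp
    ultimately have "(x, y) \<in> ?X" by simp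
    moreover have "w * \<epsilon> ^ (m * k) = ?f (x, y)"
      unfolding ef(1) by (simp add: w_def x_def y_def algebra_simps s(1)[symmetric])
    ultimately show ?thesis by blast
  qed
  then have "range (\<lambda>k. w * \<epsilon> ^ (m * k)) \<subseteq> ?f ` ?X" by blast
  moreover have "inj (\<lambda>k. w * \<epsilon> ^ (m * k))"
  proof (rule injI)
    fix k l assume "w * \<epsilon> ^ (m * k) = w * \<epsilon> ^ (m * l)"
    then have "\<bar>\<epsilon>\<bar> ^ (m * k) = \<bar>\<epsilon>\<bar> ^ (m * l)" using w by (simp flip: power_abs)
    then have "ln (\<bar>\<epsilon>\<bar> ^ (m * k)) = ln (\<bar>\<epsilon>\<bar> ^ (m * l))" by simp
    then have "real (m * k) * ln \<bar>\<epsilon>\<bar> = real (m * l) * ln \<bar>\<epsilon>\<bar>" using \<epsilon> by (simp add: ln_realpow)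
    moreover have "ln \<bar>\<epsilon>\<bar> \<noteq> 0" using \<epsilon> by (subst ln_eq_zero_iff) auto
    ultimately show "k = l" using m by simp
  qed
  then have "infinite (range (\<lambda>k. w * \<epsilon> ^ (m * k)))" by (rule range_inj_infinite)
  ultimately show ?thesis by (meson finite_imageI finite_subset)
qed

text \<open>The hypotheses express that \<open>\<pi> = c + d s\<close> divides \<open>p\<close>
(with cofactor \<open>\<alpha> + \<beta> s\<close>) and an element with \<open>s\<close>-coordinate
\<open>1\<close> (with cofactor \<open>\<gamma> + \<delta> s\<close>). The norm of
\<open>\<pi>\<close> is a multiple of \<open>p\<close> that divides \<open>p\<^sup>2\<close>. If it
were \<open>\<plusminus>p\<^sup>2\<close>, then \<open>\<pi>\<close> would be \<open>p\<close> times
a unit, so \<open>p\<close> would divide \<open>d\<close>, then \<open>c\<close>, and hence the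
coordinate \<open>1\<close>.\<close>

lemma generator_of_congruence_lattice:
  fixes a p r c d \<alpha> \<beta> \<gamma> \<delta> :: int
  assumes p: "Factorial_Ring.prime p" "p dvd r\<^sup>2 - a" "p dvd c + d * r"
    and gen: "c * \<alpha> + a * d * \<beta> = p" "c * \<beta> + d * \<alpha> = 0" "c * \<delta> + d * \<gamma> = 1"
  shows "\<not> p dvd d \<and> \<bar>c\<^sup>2 - a * d\<^sup>2\<bar> = p"
proof -
  have nd: "\<not> p dvd d"
  proof
    assume "p dvd d"
    then have "p dvd c" using p(3) by (metis dvd_add_left_iff dvd_mult2)
    with \<open>p dvd d\<close> have "p dvd 1" unfolding gen(3)[symmetric] by simp
    then show False using p(1) by (metis not_prime_unit)
  qed
  define N M where "N = c\<^sup>2 - a * d\<^sup>2" and "M = \<alpha>\<^sup>2 - a * \<beta>\<^sup>2"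
  have "N = (c + d * r) * (c - d * r) + (r\<^sup>2 - a) * d\<^sup>2" by (simp add: N_def power2_eq_square algebra_simps)
  then have "p dvd N" using p(2,3) by simp
  then obtain k where k: "N = p * k" by (elim dvdE)
  \<comment> \<open>\<open>N\<close> and \<open>M\<close> are the norms of \<open>\<pi>\<close> and of its cofactor in \<open>p\<close>.\<close>
  have "N * M = (c * \<alpha> + a * d * \<beta>)\<^sup>2 - a * (c * \<beta> + d * \<alpha>)\<^sup>2"
    by (simp add: N_def M_def power2_eq_square algebra_simps)
  then have "p * (k * M) = p * p" unfolding gen(1,2) k by (simp add: power2_eq_square mult.assoc)
  then have kM: "k * M = p" using p(1) by (metis mult_cancel_left not_prime_0)
  \<comment> \<open>Multiplying \<open>p = \<pi> (\<alpha> + \<beta> s)\<close> by the conjugate cofactor gives \<open>\<pi> M = p (\<alpha> - \<beta> s)\<close>.\<close>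
  have "d * M = - p * \<beta> + \<alpha> * (c * \<beta> + d * \<alpha>)"
    unfolding gen(1)[symmetric] M_def by (simp add: power2_eq_square algebra_simps)
  then have "p dvd d * M" unfolding gen(2) by simp
  then have "p dvd M" using nd p(1) prime_dvd_mult_iff by blast
  then obtain j where "M = p * j" by (elim dvdE)
  then have "p * (k * j) = p * 1" using kM by (simp add: mult_ac)
  then have "k * j = 1" using p(1) by (metis mult_cancel_left not_prime_0)
  then have "\<bar>k\<bar> = 1" using zmult_eq_1_iff by fastforce
  then show ?thesis using nd k prime_gt_0_int[OF p(1)] by (simp add: N_def abs_mult)
qed

text \<open>The point is \<open>\<sigma> \<pi> u\<close> with \<open>\<pi> = c + d s\<close>,
\<open>u = e + f s\<close> and \<open>\<sigma>\<close> the norm of \<open>u\<close>: modulo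
\<open>p\<close> its \<open>y\<close>-coordinate is \<open>\<sigma> d (e - f r) \<equiv> \<sigma> (e
+ f r) (e - f r) \<equiv> \<sigma>\<^sup>2 = 1\<close>.\<close>

lemma conic_point_from_unit:
  fixes a p r c d e f :: int
  assumes p: "Factorial_Ring.prime p" "p dvd r\<^sup>2 - a" "p dvd c + d * r" "\<not> p dvd d"
    and N: "\<bar>c\<^sup>2 - a * d\<^sup>2\<bar> = p"
    and u: "\<bar>e\<^sup>2 - a * f\<^sup>2\<bar> = 1" "p dvd e + f * r - d"
  shows "\<exists>x y. \<bar>x\<^sup>2 - a * y\<^sup>2\<bar> = p \<and> p dvd x + y * r \<and> [y = 1] (mod p)"
proof -
  define \<sigma> where "\<sigma> = e\<^sup>2 - a * f\<^sup>2"
  have \<sigma>: "\<bar>\<sigma>\<bar> = 1" "\<sigma> * \<sigma> = 1" using u(1) abs_mult_self_eq[of \<sigma>] by (simp_all add: \<sigma>_def)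
  define x y where "x = \<sigma> * (c * e + a * d * f)" and "y = \<sigma> * (c * f + d * e)"
  have "x\<^sup>2 - a * y\<^sup>2 = (\<sigma> * \<sigma>) * ((c\<^sup>2 - a * d\<^sup>2) * (e\<^sup>2 - a * f\<^sup>2))"
    by (simp add: x_def y_def power2_eq_square algebra_simps)
  then have "\<bar>x\<^sup>2 - a * y\<^sup>2\<bar> = p" using N u(1) \<sigma>(2) by (simp add: abs_mult)
  moreover have "x + y * r = \<sigma> * ((c + d * r) * (e + f * r) - (r\<^sup>2 - a) * (d * f))"
    by (simp add: x_def y_def power2_eq_square algebra_simps)
  then have "p dvd x + y * r" using p(2,3) by simp
  moreover have "y - 1 = \<sigma> * (f * (c + d * r) - (e - f * r) * (e + f * r - d) - (r\<^sup>2 - a) * f\<^sup>2)"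
  proof -
    have "\<sigma> * (f * (c + d * r) - (e - f * r) * (e + f * r - d) - (r\<^sup>2 - a) * f\<^sup>2)
      = \<sigma> * (c * f + d * e - (e\<^sup>2 - a * f\<^sup>2))" by (simp add: power2_eq_square algebra_simps)
    also have "\<dots> = y - \<sigma> * \<sigma>" by (simp add: y_def \<sigma>_def right_diff_distrib)
    finally show ?thesis using \<sigma>(2) by simp
  qed
  then have "[y = 1] (mod p)" using p(2,3) u(2) by (simp add: cong_iff_dvd_diff)
  ultimately show ?thesis by blast
qed

lemma finite_congruence_lattices:
  assumes "finite M"
  shows "finite {congruence_lattice s p r | p r. p \<in> M \<and> r \<in> {0..<p}}"
proof -
  have "{congruence_lattice s p r | p r. p \<in> M \<and> r \<in> {0..<p}} \<subseteq>
    (\<lambda>(p, r). congruence_lattice s p r) ` (SIGMA p:M. {0..<p})" by force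
  moreover have "finite ((\<lambda>(p, r). congruence_lattice s p r) ` (SIGMA p:M. {0..<p}))"
    using assms by simp
  ultimately show ?thesis by (rule finite_subset)
qed

text \<open>Each admissible prime \<open>P\<close> over \<open>p\<close> yields \<open>n =
\<plusminus>p\<close>. If only finitely many \<open>n\<close> occurred, then only finitely many
\<open>p\<close>, hence only finitely many \<open>P\<close>.\<close>

lemma infinitely_many_conics_with_infinitely_many_points:
  fixes a :: int
  defines "R \<equiv> ring_of_integers (quadratic_field a)"
  assumes a: "a > 0" "squarefree a" "a mod 4 \<in> {2, 3}"
    and cl: "trivial_group (class_group (quadratic_field a))"
    and inf: "infinite {P. degree_one_prime (quadratic_field a) P \<and> unit_reduction_surjective (quadratic_field a) P}"
  shows "infinite {n. n \<noteq> 0 \<and> infinite {(x, y). x\<^sup>2 - a * y\<^sup>2 = n \<and> n dvd y - 1}}"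
proof
  define s where "s = sqrt (of_int a)"
  define PP where "PP = {P. degree_one_prime (quadratic_field a) P \<and> unit_reduction_surjective (quadratic_field a) P}"
  define G where "G = {n. n \<noteq> 0 \<and> infinite {(x, y). x\<^sup>2 - a * y\<^sup>2 = n \<and> n dvd y - 1}}"
  note simps = ring_of_integers_simps[where K = "quadratic_field a", folded R_def]
  have s: "s * s = of_int a" "s \<notin> \<rat>" using a sqrt_irrational_if_mod_4[of a] by (auto simp: s_def)
  have O: "carrier R = {of_int m + of_int n * s | m n. True}"
    unfolding R_def s_def by (rule carrier_ring_of_integers_eq[OF a])
  have inR: "of_int m + of_int n * s \<in> carrier R" for m n unfolding O by blast
  have one: "1 \<in> carrier R" using inR[of 1 0] by simp
  have P: "\<exists>p r. Factorial_Ring.prime p \<and> r \<in> {0..<p} \<and> p dvd r\<^sup>2 - a \<and> P = congruence_lattice s p r \<and> ideal P R"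
    if "P \<in> PP" for P
    using that degree_one_prime_eq_congruence_lattice[of a P, folded R_def s_def, OF a(1) s(2) O]
    by (auto simp: PP_def degree_one_prime_def R_def primeideal_def)
  have unit: "\<exists>e f. \<bar>e\<^sup>2 - a * f\<^sup>2\<bar> = 1 \<and> p dvd e + f * r - d"
    if "P \<in> PP" "Factorial_Ring.prime p" "P = congruence_lattice s p r" "ideal P R" "\<not> p dvd d" for P p r d
    using unit_in_residue_class[of a P p r d, folded R_def s_def, OF a(1) s(2) O that(4,3,2)] that(1,5)
    by (auto simp: PP_def)
  obtain E F where EF: "E\<^sup>2 - a * F\<^sup>2 = 1" "F \<noteq> 0"
  proof -
    have "\<exists>P\<in>PP. \<forall>p r. P = congruence_lattice s p r \<longrightarrow> r \<in> {0..<p} \<longrightarrow> p \<notin> {0..4}"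
    proof (rule ccontr)
      assume "\<not> ?thesis"
      then have "PP \<subseteq> {congruence_lattice s p r | p r. p \<in> {0..4} \<and> r \<in> {0..<p}}" by blast
      then show False using inf finite_congruence_lattices[of "{0..4}" s] finite_subset unfolding PP_def by blast
    qed
    then obtain P where P': "P \<in> PP" "\<And>p r. P = congruence_lattice s p r \<Longrightarrow> r \<in> {0..<p} \<Longrightarrow> p \<notin> {0..4}" by blast
    obtain p r where p: "Factorial_Ring.prime p" "r \<in> {0..<p}" "P = congruence_lattice s p r" "ideal P R"
      using P[OF P'(1)] by blast
    \<comment> \<open>At \<open>p \<ge> 5\<close> the residue \<open>2\<close> differs from \<open>\<plusminus>1\<close>, so a unit reducing to it is not rational; its square has norm one.\<close>
    have p5: "p \<ge> 5" using P'(2)[OF p(3,2)] p(2) by auto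
    have "\<not> p dvd 2" using p5 zdvd_imp_le[of p 2] by auto
    then obtain e f where ef: "\<bar>e\<^sup>2 - a * f\<^sup>2\<bar> = 1" "p dvd e + f * r - 2"
      using unit[OF P'(1) p(1,3,4)] by blast
    have f: "f \<noteq> 0"
    proof
      assume "f = 0"
      then have "\<bar>e\<^sup>2\<bar> = 1" using ef(1) by simp
      then have "e = 1 \<or> e = -1" by (simp add: power2_eq_1_iff)
      then have "p dvd - 1 \<or> p dvd - 3" using ef(2) \<open>f = 0\<close> by auto
      then show False using p5 zdvd_imp_le[of p 1] zdvd_imp_le[of p 3] by auto
    qed
    have e: "e \<noteq> 0"
    proof
      assume "e = 0"
      then have "a * f\<^sup>2 = 1" using ef(1) a(1) by simp
      then have "a = 1" using a(1) by (simp add: zmult_eq_1_iff)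
      then show False using a(3) by simp
    qed
    have "(e\<^sup>2 + a * f\<^sup>2)\<^sup>2 - a * (2 * e * f)\<^sup>2 = \<bar>e\<^sup>2 - a * f\<^sup>2\<bar>\<^sup>2"
      by (simp add: power2_eq_square algebra_simps)
    then show ?thesis using that[of "e\<^sup>2 + a * f\<^sup>2" "2 * e * f"] ef(1) e f by simp
  qed
  assume "finite G"
  have "PP \<subseteq> {congruence_lattice s p r | p r. p \<in> abs ` G \<and> r \<in> {0..<p}}"
  proof
    fix P assume PPP: "P \<in> PP"
    then obtain p r where p: "Factorial_Ring.prime p" "r \<in> {0..<p}" "p dvd r\<^sup>2 - a"
      "P = congruence_lattice s p r" "ideal P R" using P by blast
    have p0: "p > 0" using prime_gt_0_int[OF p(1)] .
    have mem: "of_int m + of_int n * s \<in> P \<longleftrightarrow> p dvd m + n * r" for m n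
      unfolding p(4) congruence_lattice_def using quadratic_coordinates_unique[OF s(2)] by blast
    \<comment> \<open>The elements \<open>p\<close> and \<open>s - r\<close> generate the lattice; being multiples of \<open>\<pi>\<close> they determine its norm.\<close>
    have pP: "of_int p + of_int 0 * s \<in> P" "of_int (- r) + of_int 1 * s \<in> P" unfolding mem by auto
    then have "P \<noteq> {0}" using p0 by auto
    moreover have "1 \<in> quadratic_field a" using one by (simp add: simps)
    ultimately obtain z where z: "z \<in> carrier R" "P = (\<lambda>x. z * x) ` carrier R"
      using ideal_principal_if_class_group_trivial[of "quadratic_field a" P, folded R_def, OF cl p(5)] by blast
    obtain c d where cd: "z = of_int c + of_int d * s" using z(1) unfolding O by blast
    have mult: "\<exists>\<alpha> \<beta>. m = c * \<alpha> + a * d * \<beta> \<and> n = c * \<beta> + d * \<alpha>"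
      if mn: "of_int m + of_int n * s \<in> P" for m n
    proof -
      obtain \<alpha> \<beta> where "of_int m + of_int n * s = z * (of_int \<alpha> + of_int \<beta> * s)"
        using mn unfolding z(2) O by blast
      also have "\<dots> = of_int (c * \<alpha> + a * d * \<beta>) + of_int (c * \<beta> + d * \<alpha>) * s"
        unfolding cd by (simp add: algebra_simps s(1)[symmetric])
      finally show ?thesis using quadratic_coordinates_unique[OF s(2)] by blast
    qed
    have "of_int c + of_int d * s \<in> P" unfolding z(2) cd using one by force
    then have cdr: "p dvd c + d * r" unfolding mem .
    obtain \<alpha> \<beta> \<gamma> \<delta> where "p = c * \<alpha> + a * d * \<beta>" "0 = c * \<beta> + d * \<alpha>" "1 = c * \<delta> + d * \<gamma>"
      using mult[OF pP(1)] mult[OF pP(2)] by blast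
    then have nd: "\<not> p dvd d" "\<bar>c\<^sup>2 - a * d\<^sup>2\<bar> = p"
      using generator_of_congruence_lattice[OF p(1,3) cdr, of \<alpha> \<beta> \<delta> \<gamma>] by auto
    obtain e f where ef: "\<bar>e\<^sup>2 - a * f\<^sup>2\<bar> = 1" "p dvd e + f * r - d"
      using unit[OF PPP p(1,4,5) nd(1)] by blast
    obtain x y where xy: "\<bar>x\<^sup>2 - a * y\<^sup>2\<bar> = p" "p dvd x + y * r" "[y = 1] (mod p)"
      using conic_point_from_unit[OF p(1,3) cdr nd ef] by blast
    define n where "n = x\<^sup>2 - a * y\<^sup>2"
    have n: "\<bar>n\<bar> = p" "n \<noteq> 0" "n dvd p" using xy(1) p0 by (auto simp: n_def)
    have "infinite {(x, y). x\<^sup>2 - a * y\<^sup>2 = n \<and> n dvd y - 1}"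
      using infinitely_many_points_on_conic[OF a(1) s(2)[unfolded s_def] p(1,3) n(2,3) n_def[symmetric] xy(2,3) EF] .
    then have "p \<in> abs ` G" using n unfolding G_def by auto
    then show "P \<in> {congruence_lattice s p r | p r. p \<in> abs ` G \<and> r \<in> {0..<p}}" using p(2,4) by blast
  qed
  then show False using inf finite_congruence_lattices[of "abs ` G" s] \<open>finite G\<close> finite_subset unfolding PP_def by blast
qed

section \<open>Zariski density of the integral points\<close>

theorem proposition4p1p3:
  fixes a :: int and L :: "real set" and F :: poly3
  assumes "a > 0" and "squarefree a"
  defines "L \<equiv> quadratic_field a"
  defines "F \<equiv> (X_var ^ 2 - of_int a * Y_var ^ 2) * T_var - (Y_var - 1)"
  assumes "ring.dimension real_ring 2 \<rat> L"
    and "ramified_at L 2"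
    and "trivial_group (class_group L)"
    and "infinite {P. degree_one_prime L P \<and> unit_reduction_surjective L P}"
  shows "integral_points_zariski_dense F"
proof -
  have a4: "a mod 4 \<in> {2, 3}"
    using ramified_at_2_imp_mod_4[OF assms(1,2)] \<open>ramified_at L 2\<close> unfolding L_def by blast
  have "infinite {n. n \<noteq> 0 \<and> infinite {(x, y). x\<^sup>2 - a * y\<^sup>2 = n \<and> n dvd y - 1}}"
    using infinitely_many_conics_with_infinitely_many_points[OF assms(1,2) a4, folded L_def]
      \<open>trivial_group (class_group L)\<close>
      \<open>infinite {P. degree_one_prime L P \<and> unit_reduction_surjective L P}\<close> by blast
  then show ?thesis unfolding F_def
    by (intro zariski_dense_if_vanishing_implies_divisible
        divisible_if_vanishing_on_integral_points[OF assms(1) sqrt_irrational_if_mod_4[OF assms(1) a4]])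
qed

end
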